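(* There exists a complete holomorphic Legendrian immersion $F\colon\mathbb{D}_1\to\mathbb{C}^3$ of the unit disk $\mathbb{D}_1=\{z\in\mathbb{C}:|z|<1\}$ whose image is bounded in $\mathbb{C}^3$.
   Context: Let $(x_1,x_2,x_3)$ be the canonical complex coordinates of $\mathbb{C}^3$. A holomorphic map $F\colon\mathbb{D}_1\to\mathbb{C}^3$ is called Legendrian if $F^*\Omega_{\mathbb{C}}=0$, where $\Omega_{\mathbb{C}}:=dx_3+x_2\,dx_1$. A holomorphic immersion $F$ is complete if the pull-back by $F$ of the standard Hermitian (Euclidean) metric of $\mathbb{C}^3$ is a complete Riemannian metric on $\mathbb{D}_1$. *)

theory Defs
  imports "HOL-Complex_Analysis.Complex_Analysis"
begin

definition holomorphic_map_on :: "(complex \<Rightarrow> complex ^ 'n) \<Rightarrow> complex set \<Rightarrow> bool" where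
  "holomorphic_map_on F S \<longleftrightarrow> (\<forall>i. (\<lambda>z. F z $ i) holomorphic_on S)"

definition immersion_on ::
    "('a::real_normed_vector \<Rightarrow> 'b::real_normed_vector) \<Rightarrow> 'a set \<Rightarrow> bool" where
  "immersion_on F S \<longleftrightarrow>
     (\<forall>p\<in>S. F differentiable (at p) \<and> inj (frechet_derivative F (at p)))"

text \<open>The one-form \<open>dx\<^sub>3 + x\<^sub>2 dx\<^sub>1\<close> at the point \<open>p\<close>, evaluated on the tangent vector \<open>w\<close>.\<close>

definition contact_form :: "complex ^ 3 \<Rightarrow> complex ^ 3 \<Rightarrow> complex" where
  "contact_form p w = w $ 3 + p $ 2 * w $ 1"

definition legendrian_on :: "(complex \<Rightarrow> complex ^ 3) \<Rightarrow> complex set \<Rightarrow> bool" where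
  "legendrian_on F S \<longleftrightarrow>
     (\<forall>z\<in>S. \<forall>v. contact_form (F z) (frechet_derivative F (at z) v) = 0)"

text \<open>A (Riemannian) metric is represented by \<open>g p v w\<close>, the inner product at \<open>p\<close> of the tangent
  vectors \<open>v\<close> and \<open>w\<close>.  The real inner product of \<open>complex ^ 'n\<close> is the real part of the standard
  Hermitian product.\<close>

definition pullback_metric ::
    "('a::real_normed_vector \<Rightarrow> 'b::real_inner) \<Rightarrow> 'a \<Rightarrow> 'a \<Rightarrow> 'a \<Rightarrow> real" where
  "pullback_metric F p v w = frechet_derivative F (at p) v \<bullet> frechet_derivative F (at p) w"

definition riem_speed ::
    "('a::real_normed_vector \<Rightarrow> 'a \<Rightarrow> 'a \<Rightarrow> real) \<Rightarrow> (real \<Rightarrow> 'a) \<Rightarrow> real \<Rightarrow> real" where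
  "riem_speed g \<gamma> t =
     sqrt (g (\<gamma> t) (vector_derivative \<gamma> (at t)) (vector_derivative \<gamma> (at t)))"

text \<open>A \<^const>\<open>valid_path\<close> is continuous and \<open>C\<^sup>1\<close> off a finite set, but its derivative may be
  unbounded near the exceptional points.  Without the integrability condition a path of infinite
  length would get the integral \<open>0\<close>.\<close>

definition riem_paths ::
    "'a::real_normed_vector set \<Rightarrow> ('a \<Rightarrow> 'a \<Rightarrow> 'a \<Rightarrow> real) \<Rightarrow> 'a \<Rightarrow> 'a \<Rightarrow> (real \<Rightarrow> 'a) set" where
  "riem_paths S g p q =
     {\<gamma>. valid_path \<gamma> \<and> path_image \<gamma> \<subseteq> S \<and> pathstart \<gamma> = p \<and> pathfinish \<gamma> = q \<and>
         riem_speed g \<gamma> integrable_on {0..1}}"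

text \<open>The value off \<open>S\<close> is immaterial; it is set to \<open>0\<close> because \<^locale>\<open>Metric_space\<close> asks the
  distance to be nonnegative on the whole type.\<close>

definition riem_dist ::
    "'a::real_normed_vector set \<Rightarrow> ('a \<Rightarrow> 'a \<Rightarrow> 'a \<Rightarrow> real) \<Rightarrow> 'a \<Rightarrow> 'a \<Rightarrow> real" where
  "riem_dist S g p q =
     (if p \<in> S \<and> q \<in> S then INF \<gamma>\<in>riem_paths S g p q. integral {0..1} (riem_speed g \<gamma>) else 0)"

definition complete_riemannian ::
    "'a::real_normed_vector set \<Rightarrow> ('a \<Rightarrow> 'a \<Rightarrow> 'a \<Rightarrow> real) \<Rightarrow> bool" where
  "complete_riemannian S g \<longleftrightarrow>
     Metric_space S (riem_dist S g) \<and> Metric_space.mcomplete S (riem_dist S g)"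

end

(* In the coordinates x1 = exp u, x3 = exp w, x2 = -m exp (w - u) the Legendrian condition reads
   dw = m du, and boundedness only requires Re u, Re w and m to be bounded.  On the unit circle control
   the potential phi = (Re u)^2 + (Re w)^2 + |m - i|^2.  With A = Re u + m Re w and B = cnj (m - i), its
   differential along a Legendrian displacement is 2 Re (A du + B dm), and (A, B) does not vanish as long
   as phi >= 1/4.  For polynomials u, m, w and large M the functions z^M A and z^M B are polynomials on
   the circle, so (u, m) can be moved by eps z^M (-B, A) inside the disk: phi changes by O(eps^2) only
   (the correction of w is O(1/M)), while crossing an annulus at distance about 1/M from the circle now
   costs a length of order eps.  Taking eps_n of order 1/n makes phi converge and the lengths diverge,
   so the limit is bounded and complete.  Adding a generic linear term to u makes it immersed. *)
theory Submission
  imports Defs "HOL-Real_Asymp.Real_Asymp"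
begin

section \<open>Conformal metrics on the unit disk\<close>

text \<open>The obstacle is that the differential of the potential, restricted to Legendrian
  displacements, must not vanish where the potential is large. For the Hermitian norm of C^3 it
  restricts to \<open>(cnj x1 - x2 cnj x3) dx1 + cnj x2 dx2\<close>, which vanishes along the whole
  \<open>x3\<close>-axis, so nothing would keep the perturbation direction away from zero there.
  With exponentials only the real parts of \<open>u\<close> and \<open>w\<close> need bounds, and
  centring \<open>m\<close> at \<open>\<i>\<close> lets one complex coefficient control both: at
  \<open>m = \<i>\<close> it is \<open>A = Re u + \<i> Re w\<close>, so \<open>A = B = 0\<close>
  forces the potential itself to vanish. Centred at 0, the coefficient at \<open>m = 0\<close> would
  be \<open>Re u\<close> alone, blind to \<open>Re w\<close>. The potential on the circle therefore
  stays in a band: its upper end gives boundedness, its lower end a direction of definite size.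
  Later steps must not destroy the length won on earlier annuli. Hence each step is small, together
  with its derivatives, on a disk containing those annuli; multiplying by \<open>z ^ M\<close>
  achieves this, since \<open>M R ^ M\<close> tends to 0 for \<open>R < 1\<close>.\<close>

locale conformal_disk =
  fixes F :: "complex \<Rightarrow> 'b::real_inner" and \<rho> :: "complex \<Rightarrow> real"
  assumes norm_frechet_derivative:
      "z \<in> ball 0 1 \<Longrightarrow> norm (frechet_derivative F (at z) v) = \<rho> z * norm v"
    and density_continuous: "continuous_on (ball 0 1) \<rho>"
    and density_pos: "z \<in> ball 0 1 \<Longrightarrow> 0 < \<rho> z"
begin

abbreviation "paths \<equiv> riem_paths (ball 0 1) (pullback_metric F)"
abbreviation "speed \<equiv> riem_speed (pullback_metric F)"
abbreviation "dst \<equiv> riem_dist (ball 0 1) (pullback_metric F)"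

section \<open>Lengths of segments, reversed paths and joined paths\<close>

lemma speed_eq:
  assumes "\<gamma> t \<in> ball 0 1"
  shows "speed \<gamma> t = \<rho> (\<gamma> t) * norm (vector_derivative \<gamma> (at t))"
  unfolding riem_speed_def pullback_metric_def
  using norm_frechet_derivative[OF assms] by (simp add: norm_eq_sqrt_inner)

lemma speed_nonneg: "0 \<le> speed \<gamma> t"
  by (simp add: riem_speed_def pullback_metric_def)

lemma speed_has_integral:
  assumes "\<gamma> \<in> paths p q"
  shows "(speed \<gamma> has_integral integral {0..1} (speed \<gamma>)) {0..1}"
  using assms by (auto simp: riem_paths_def integrable_integral)

lemma path_in_disk:
  assumes "\<gamma> \<in> paths p q" "0 \<le> t" "t \<le> 1"
  shows "\<gamma> t \<in> ball 0 1"
proof -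
  have "\<gamma> ` {0..1} \<subseteq> ball 0 1" using assms(1) by (simp add: riem_paths_def path_image_def)
  then show ?thesis using assms(2,3) by (meson atLeastAtMost_iff image_subset_iff)
qed

lemma paths_endpoints:
  assumes "\<gamma> \<in> paths p q"
  shows "p \<in> ball 0 1" "q \<in> ball 0 1"
  using path_in_disk[OF assms, of 0] path_in_disk[OF assms, of 1] assms
  by (auto simp: riem_paths_def pathstart_def pathfinish_def)

text \<open>Segments serve twice: they make the set of admissible paths nonempty, so that the
  infimum defining \<open>dst\<close> is a genuine one, and they bound \<open>dst\<close> by a
  multiple of the Euclidean distance wherever the density is bounded.\<close>

lemma linepath_in_paths:
  assumes "p \<in> ball 0 1" "q \<in> ball 0 1"
  shows "linepath p q \<in> paths p q"
    and "(\<And>z. z \<in> closed_segment p q \<Longrightarrow> \<rho> z \<le> K) \<Longrightarrow>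
           integral {0..1} (speed (linepath p q)) \<le> K * norm (q - p)"
proof -
  have seg: "closed_segment p q \<subseteq> ball 0 1"
    using assms by (simp add: closed_segment_subset)
  have im: "linepath p q t \<in> closed_segment p q" if "t \<in> {0..1}" for t
    using that by (auto simp: path_image_linepath[symmetric] path_image_def simp del: path_image_linepath)
  have sp: "speed (linepath p q) t = \<rho> (linepath p q t) * norm (q - p)" if "t \<in> {0..1}" for t
    using speed_eq[of "linepath p q" t] im[OF that] seg by auto
  have cont: "continuous_on {0..1} (\<lambda>t. \<rho> (linepath p q t) * norm (q - p))"
    by (intro continuous_intros continuous_on_compose2[OF density_continuous]) (use im seg in auto)
  have int: "speed (linepath p q) integrable_on {0..1}"
    using integrable_continuous_interval[OF cont] sp by (subst integrable_cong[OF sp]) auto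
  then show "linepath p q \<in> paths p q"
    using seg by (auto simp: riem_paths_def)
  assume K: "\<And>z. z \<in> closed_segment p q \<Longrightarrow> \<rho> z \<le> K"
  have "integral {0..1} (speed (linepath p q)) \<le> integral {0..1} (\<lambda>t::real. K * norm (q - p))"
    by (rule integral_le[OF int]) (use sp K im in \<open>auto intro!: mult_right_mono\<close>)
  then show "integral {0..1} (speed (linepath p q)) \<le> K * norm (q - p)"
    by simp
qed

lemma reversepath_in_paths:
  assumes \<gamma>: "\<gamma> \<in> paths p q"
  shows "reversepath \<gamma> \<in> paths q p"
    and "integral {0..1} (speed (reversepath \<gamma>)) = integral {0..1} (speed \<gamma>)"
proof -
  have v: "valid_path \<gamma>" using \<gamma> by (auto simp: riem_paths_def)
  then obtain S where S: "finite S" "\<And>t. t \<in> {0..1} - S \<Longrightarrow> \<gamma> differentiable at t"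
    by (auto simp: valid_path_def piecewise_C1_differentiable_on_def C1_differentiable_on_eq)
  have "((\<lambda>t. speed \<gamma> (1 - t)) has_integral integral {0..1} (speed \<gamma>)) {0..1}"
    using has_integral_affinity01[where m = "-1" and c = 1, OF speed_has_integral[OF \<gamma>]] by simp
  then have "(speed (reversepath \<gamma>) has_integral integral {0..1} (speed \<gamma>)) {0..1}"
  proof (rule has_integral_spike_finite[rotated 2])
    show "finite ((\<lambda>t. 1 - t) ` S)" using S by simp
    fix t :: real assume t: "t \<in> {0..1} - (\<lambda>t. 1 - t) ` S"
    then have "1 - t \<in> {0..1} - S" by (auto simp: image_iff)
    then have d: "(\<gamma> has_vector_derivative vector_derivative \<gamma> (at (1 - t))) (at (1 - t))"
      using S(2) vector_derivative_works by blast
    have "(\<gamma> \<circ> (\<lambda>t. 1 - t) has_vector_derivative -1 *\<^sub>R vector_derivative \<gamma> (at (1 - t))) (at t)"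
      by (intro vector_diff_chain_within has_vector_derivative_at_within[OF d] derivative_eq_intros | simp)+
    then have "vector_derivative (reversepath \<gamma>) (at t) = - vector_derivative \<gamma> (at (1 - t))"
      by (intro vector_derivative_at) (simp add: o_def reversepath_def)
    then show "speed (reversepath \<gamma>) t = speed \<gamma> (1 - t)"
      using t speed_eq[of "reversepath \<gamma>" t] speed_eq[of \<gamma> "1 - t"] path_in_disk[OF \<gamma>, of "1 - t"]
      by (simp add: reversepath_def)
  qed
  then show "reversepath \<gamma> \<in> paths q p" "integral {0..1} (speed (reversepath \<gamma>)) = integral {0..1} (speed \<gamma>)"
    using \<gamma> by (auto simp: riem_paths_def integral_unique has_integral_integrable)
qed

lemma joinpaths_in_paths:
  assumes g1: "g1 \<in> paths p q" and g2: "g2 \<in> paths q r"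
  shows "g1 +++ g2 \<in> paths p r"
    and "integral {0..1} (speed (g1 +++ g2)) = integral {0..1} (speed g1) + integral {0..1} (speed g2)"
proof -
  have v: "valid_path g1" "valid_path g2" "pathfinish g1 = pathstart g2"
    using g1 g2 by (auto simp: riem_paths_def)
  obtain s1 s2
    where s1: "finite s1" "\<forall>x\<in>{0..1} - s1. g1 differentiable at x"
      and s2: "finite s2" "\<forall>x\<in>{0..1} - s2. g2 differentiable at x"
    using v
    by (auto simp: valid_path_def piecewise_C1_differentiable_on_def C1_differentiable_on_eq)
  have i1: "((\<lambda>x. 2 * speed g1 (2*x)) has_integral integral {0..1} (speed g1)) {0..1/2}"
   and i2: "((\<lambda>x. 2 * speed g2 (2*x - 1)) has_integral integral {0..1} (speed g2)) {1/2..1}"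
    using has_integral_affinity01 [OF speed_has_integral[OF g1], where m= 2 and c=0, THEN has_integral_cmul [where c=2]]
          has_integral_affinity01 [OF speed_has_integral[OF g2], where m= 2 and c="-1", THEN has_integral_cmul [where c=2]]
    by (simp_all only: image_affinity_atLeastAtMost_div_diff, simp_all add: mult_ac)
  have d1: "vector_derivative (g1 +++ g2) (at z) = 2 *\<^sub>R vector_derivative g1 (at (2 * z))"
      if "0 \<le> z" "2 * z < 1" "2 * z \<notin> s1" for z
  proof (rule vector_derivative_at [OF has_vector_derivative_transform_within])
    show "0 < \<bar>z - 1/2\<bar>"
      using that by auto
    have "((*) 2 has_vector_derivative 2) (at z)"
      by (simp add: has_vector_derivative_def has_derivative_def bounded_linear_mult_left)
    moreover have "(g1 has_vector_derivative vector_derivative g1 (at (2 * z))) (at (2 * z))"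
      using s1 that by (auto simp: algebra_simps vector_derivative_works)
    ultimately
    show "((\<lambda>x. g1 (2 * x)) has_vector_derivative 2 *\<^sub>R vector_derivative g1 (at (2 * z))) (at z)"
      by (intro vector_diff_chain_at [simplified o_def])
  qed (use that in \<open>simp_all add: joinpaths_def dist_real_def abs_if split: if_split_asm\<close>)
  have d2: "vector_derivative (g1 +++ g2) (at z) = 2 *\<^sub>R vector_derivative g2 (at (2 * z - 1))"
      if "1 < 2 * z" "z \<le> 1" "2 * z - 1 \<notin> s2" for z
  proof (rule vector_derivative_at [OF has_vector_derivative_transform_within])
    show "0 < \<bar>z - 1/2\<bar>"
      using that by auto
    have "((\<lambda>x. 2 * x - 1) has_vector_derivative 2) (at z)"
      by (simp add: has_vector_derivative_def has_derivative_def bounded_linear_mult_left)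
    moreover have "(g2 has_vector_derivative vector_derivative g2 (at (2 * z - 1))) (at (2 * z - 1))"
      using s2 that by (auto simp: algebra_simps vector_derivative_works)
    ultimately
    show "((\<lambda>x. g2 (2 * x - 1)) has_vector_derivative 2 *\<^sub>R vector_derivative g2 (at (2 * z - 1))) (at z)"
      by (intro vector_diff_chain_at [simplified o_def])
  qed (use that in \<open>simp_all add: joinpaths_def dist_real_def abs_if split: if_split_asm\<close>)
  have "(speed (g1 +++ g2) has_integral integral {0..1} (speed g1)) {0..1/2}"
  proof (rule has_integral_spike_finite [OF _ _ i1])
    show "finite (insert (1/2) ((*) 2 -` s1))"
      using s1 by (force intro: finite_vimageI [where h = "(*)2"] inj_onI)
    fix x :: real assume x: "x \<in> {0..1/2} - insert (1/2) ((*) 2 -` s1)"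
    then show "speed (g1 +++ g2) x = 2 * speed g1 (2 * x)"
      using d1[of x] path_in_disk[OF g1, of "2 * x"] speed_eq[of "g1 +++ g2" x] speed_eq[of g1 "2 * x"]
      by (auto simp: joinpaths_def)
  qed
  moreover have "(speed (g1 +++ g2) has_integral integral {0..1} (speed g2)) {1/2..1}"
  proof (rule has_integral_spike_finite [OF _ _ i2])
    show "finite (insert (1/2) ((\<lambda>x. 2 * x - 1) -` s2))"
      using s2 by (force intro: finite_vimageI [where h = "\<lambda>x. 2*x-1"] inj_onI)
    fix x :: real assume x: "x \<in> {1/2..1} - insert (1/2) ((\<lambda>x. 2 * x - 1) -` s2)"
    then show "speed (g1 +++ g2) x = 2 * speed g2 (2 * x - 1)"
      using d2[of x] path_in_disk[OF g2, of "2 * x - 1"] speed_eq[of "g1 +++ g2" x] speed_eq[of g2 "2 * x - 1"]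
      by (auto simp: joinpaths_def)
  qed
  ultimately have "(speed (g1 +++ g2) has_integral
      integral {0..1} (speed g1) + integral {0..1} (speed g2)) {0..1}"
    by (rule has_integral_combine[rotated 2]) auto
  then show "g1 +++ g2 \<in> paths p r"
      "integral {0..1} (speed (g1 +++ g2)) = integral {0..1} (speed g1) + integral {0..1} (speed g2)"
    using g1 g2 v by (auto simp: riem_paths_def integral_unique has_integral_integrable
        path_image_join valid_path_join)
qed

section \<open>The path metric and a criterion for its completeness\<close>

lemma integral_speed_nonneg: "0 \<le> integral {a..b} (speed \<gamma>)"
  \<comment> \<open>A speed that is not integrable has integral 0 by default, so the bound holds in
    that case too.\<close>
  by (cases "speed \<gamma> integrable_on {a..b}")
     (auto intro: integral_nonneg speed_nonneg simp: not_integrable_integral)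

lemma bdd_below_lengths: "bdd_below ((\<lambda>\<gamma>. integral {0..1} (speed \<gamma>)) ` paths p q)"
  by (rule bdd_belowI[of _ 0]) (auto intro: integral_speed_nonneg)

lemma dst_le_length: "\<gamma> \<in> paths p q \<Longrightarrow> dst p q \<le> integral {0..1} (speed \<gamma>)"
  using paths_endpoints[of \<gamma> p q] unfolding riem_dist_def
  by (auto intro!: cINF_lower[OF bdd_below_lengths])

lemma dst_geI:
  assumes "p \<in> ball 0 1" "q \<in> ball 0 1"
    and "\<And>\<gamma>. \<gamma> \<in> paths p q \<Longrightarrow> c \<le> integral {0..1} (speed \<gamma>)"
  shows "c \<le> dst p q"
  unfolding riem_dist_def using assms linepath_in_paths(1)[OF assms(1,2)]
  by (auto intro!: cINF_greatest)

lemma dst_approx: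
  assumes "p \<in> ball 0 1" "q \<in> ball 0 1" "dst p q < c"
  obtains \<gamma> where "\<gamma> \<in> paths p q" "integral {0..1} (speed \<gamma>) < c"
  using dst_geI[OF assms(1,2), of c] assms(3) by (metis leD not_le_imp_less)

text \<open>Between the last time at distance \<open>r\<close> before the first arrival at distance
  \<open>s\<close>, and that arrival, the path stays where the density is at least
  \<open>\<kappa>\<close>; its length there is at least \<open>\<kappa>\<close> times the
  displacement. The equation for \<open>\<gamma> t0\<close> is reported so that the argument can be
  repeated on the part of the path before \<open>t0\<close>.\<close>

lemma crossing_length:
  assumes \<gamma>: "\<gamma> \<in> paths p q" and ab: "0 \<le> a" "a \<le> b" "b \<le> 1"
    and ra: "dist c (\<gamma> a) \<le> r" and sb: "s \<le> dist c (\<gamma> b)" and rs: "r \<le> s"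
    and \<kappa>: "0 < \<kappa>" "\<And>z. z \<in> ball 0 1 \<Longrightarrow> r \<le> dist c z \<Longrightarrow> dist c z \<le> s \<Longrightarrow> \<kappa> \<le> \<rho> z"
  obtains t0 t1 where "a \<le> t0" "t0 \<le> t1" "t1 \<le> b" "r = dist c (\<gamma> t0)"
    "\<kappa> * (s - r) \<le> integral {t0..t1} (speed \<gamma>)"
proof -
  have cont: "continuous_on {0..1} \<gamma>"
    using \<gamma> by (auto simp: riem_paths_def valid_path_def piecewise_C1_differentiable_on_def)
  let ?d = "\<lambda>t. dist c (\<gamma> t)"
  have cd: "continuous_on {a..b} ?d"
    using ab by (intro continuous_intros continuous_on_subset[OF cont]) auto
  have "\<exists>t\<in>{a..b}. ?d t \<ge> s \<and> (\<forall>t'\<in>{a..b}. t' < t \<longrightarrow> ?d t' < s)"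
  proof -
    let ?S = "{t \<in> {a..b}. s \<le> ?d t}"
    have "closed ?S"
      by (intro continuous_on_closed_Collect_le cd continuous_intros)
    moreover have "b \<in> ?S" using ab sb by auto
    moreover have "bdd_below ?S" by (rule bdd_belowI[of _ a]) auto
    ultimately have "Inf ?S \<in> ?S" by (intro closed_contains_Inf) auto
    moreover have "?d t' < s" if "t' \<in> {a..b}" "t' < Inf ?S" for t'
      using that cInf_lower[OF _ \<open>bdd_below ?S\<close>, of t'] by force
    ultimately show ?thesis by blast
  qed
  then obtain t1 where t1: "t1 \<in> {a..b}" "?d t1 \<ge> s" "\<And>t'. t' \<in> {a..b} \<Longrightarrow> t' < t1 \<Longrightarrow> ?d t' < s"
    by blast
  have le_s: "?d t \<le> s" if "t \<in> {a..t1}" "t \<noteq> t1" for t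
    using t1(1) t1(3)[of t] that by auto
  have d1: "?d t1 = s"
  proof (rule antisym[OF _ t1(2)])
    show "?d t1 \<le> s"
    proof (cases "t1 = a")
      case True then show ?thesis using ra rs by auto
    next
      case False
      have "continuous_on {a..t1} ?d" using t1(1) by (intro continuous_on_subset[OF cd]) auto
      moreover have "closure {a..<t1} = {a..t1}" using False t1(1) by auto
      ultimately show ?thesis
        using continuous_le_on_closure[of "{a..<t1}" ?d t1 s] le_s False t1(1) by auto
    qed
  qed
  \<comment> \<open>\<open>t1\<close> is the first time at distance at least \<open>s\<close>; the
    last time before it at distance at most \<open>r\<close> is now chosen, so that nothing in
    between leaves the annulus.\<close>
  have "\<exists>t\<in>{a..t1}. ?d t \<le> r \<and> (\<forall>t'\<in>{a..t1}. t < t' \<longrightarrow> r < ?d t')"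
  proof -
    let ?S = "{t \<in> {a..t1}. ?d t \<le> r}"
    have cd1: "continuous_on {a..t1} ?d" using t1(1) by (intro continuous_on_subset[OF cd]) auto
    have "closed ?S"
      by (intro continuous_on_closed_Collect_le cd1 continuous_intros)
    moreover have "a \<in> ?S" using t1(1) ra by auto
    moreover have "bdd_above ?S" by (rule bdd_aboveI[of _ t1]) auto
    ultimately have "Sup ?S \<in> ?S" by (intro closed_contains_Sup) auto
    moreover have "r < ?d t'" if "t' \<in> {a..t1}" "Sup ?S < t'" for t'
      using that cSup_upper[OF _ \<open>bdd_above ?S\<close>, of t'] by force
    ultimately show ?thesis by blast
  qed
  then obtain t0 where t0: "t0 \<in> {a..t1}" "?d t0 \<le> r" "\<And>t'. t' \<in> {a..t1} \<Longrightarrow> t0 < t' \<Longrightarrow> r < ?d t'"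
    by blast
  have d0: "?d t0 = r"
  proof (rule antisym[OF t0(2)])
    show "r \<le> ?d t0"
    proof (cases "t0 = t1")
      case True then show ?thesis using d1 rs by auto
    next
      case False
      have "continuous_on {t0..t1} ?d" using t1(1) t0(1) by (intro continuous_on_subset[OF cd]) auto
      moreover have "closure {t0<..t1} = {t0..t1}" using False t0(1) by auto
      ultimately show ?thesis
        using continuous_ge_on_closure[of "{t0<..t1}" ?d t0 r] t0 False by (auto intro: less_imp_le)
    qed
  qed
  have range: "\<gamma> t \<in> ball 0 1 \<and> \<kappa> \<le> \<rho> (\<gamma> t)" if "t \<in> {t0..t1}" for t
  proof -
    have "r \<le> ?d t" using t0(3)[of t] d0 that t0(1) by (cases "t = t0") auto
    moreover have "?d t \<le> s" using le_s[of t] d1 that t0(1) by (cases "t = t1") auto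
    moreover have "\<gamma> t \<in> ball 0 1" using path_in_disk[OF \<gamma>, of t] that t0(1) t1(1) ab by auto
    ultimately show ?thesis using \<kappa>(2) by auto
  qed
  obtain S where S: "finite S" "\<And>t. t \<in> {0..1} - S \<Longrightarrow> \<gamma> differentiable at t"
    using \<gamma> by (auto simp: riem_paths_def valid_path_def piecewise_C1_differentiable_on_def C1_differentiable_on_eq)
  have sub: "{t0..t1} \<subseteq> {0..1}" using t0(1) t1(1) ab by auto
  have hi: "((\<lambda>t. vector_derivative \<gamma> (at t)) has_integral (\<gamma> t1 - \<gamma> t0)) {t0..t1}"
  proof (rule fundamental_theorem_of_calculus_strong[OF S(1)])
    show "(\<gamma> has_vector_derivative vector_derivative \<gamma> (at t)) (at t)" if "t \<in> {t0..t1} - S" for t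
      using S(2)[of t] that sub vector_derivative_works by blast
  qed (use t0(1) continuous_on_subset[OF cont sub] in auto)
  have ig: "speed \<gamma> integrable_on {t0..t1}"
    using \<gamma> integrable_on_subinterval[OF _ sub] unfolding riem_paths_def by blast
  have "\<kappa> * (s - r) \<le> \<kappa> * norm (\<gamma> t1 - \<gamma> t0)"
  proof -
    have "s - r \<le> dist (\<gamma> t1) (\<gamma> t0)" using d0 d1 dist_triangle[of c "\<gamma> t1" "\<gamma> t0"] by (simp add: dist_commute)
    then show ?thesis using \<kappa>(1) by (simp add: dist_norm)
  qed
  also have "\<dots> = norm (integral {t0..t1} (\<lambda>t. \<kappa> *\<^sub>R vector_derivative \<gamma> (at t)))"
    using hi \<kappa>(1) by (simp add: integral_unique)
  also have "\<dots> \<le> integral {t0..t1} (speed \<gamma>)"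
  proof (rule integral_norm_bound_integral[OF _ ig])
    show "(\<lambda>t. \<kappa> *\<^sub>R vector_derivative \<gamma> (at t)) integrable_on {t0..t1}"
      using hi by (intro integrable_cmul) (auto simp: has_integral_integrable)
    show "norm (\<kappa> *\<^sub>R vector_derivative \<gamma> (at t)) \<le> speed \<gamma> t" if "t \<in> {t0..t1}" for t
      using range[OF that] \<kappa>(1) by (simp add: speed_eq mult_right_mono)
  qed
  finally show thesis using that[of t0 t1] t0(1) t1(1) d0 by auto
qed

lemma integral_speed_split:
  assumes \<gamma>: "\<gamma> \<in> paths p q" and "0 \<le> a" "a \<le> t0" "t0 \<le> t1" "t1 \<le> b" "b \<le> 1"
  shows "integral {a..t0} (speed \<gamma>) + integral {t0..t1} (speed \<gamma>) \<le> integral {a..b} (speed \<gamma>)"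
proof -
  have i: "speed \<gamma> integrable_on {x..y}" if "0 \<le> x" "y \<le> 1" for x y
    using \<gamma> that by (auto simp: riem_paths_def intro: integrable_on_subinterval)
  have "integral {a..t1} (speed \<gamma>) + integral {t1..b} (speed \<gamma>) = integral {a..b} (speed \<gamma>)"
    using assms by (intro Henstock_Kurzweil_Integration.integral_combine i) auto
  moreover have "integral {a..t0} (speed \<gamma>) + integral {t0..t1} (speed \<gamma>) = integral {a..t1} (speed \<gamma>)"
    using assms by (intro Henstock_Kurzweil_Integration.integral_combine i) auto
  ultimately show ?thesis using integral_speed_nonneg[of t1 b \<gamma>] by linarith
qed

lemma dst_pos:
  assumes "p \<in> ball 0 1" "q \<in> ball 0 1" "p \<noteq> q"
  shows "0 < dst p q"
proof -
  obtain e where e: "e > 0" "cball p e \<subseteq> ball 0 1"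
    using assms(1) open_contains_cball open_ball by metis
  \<comment> \<open>The bound by \<open>dist p q\<close> forces every path to \<open>q\<close> to
    reach distance \<open>s\<close>; the bound by \<open>e\<close> keeps the disk of radius
    \<open>s\<close> inside a compact disk, on which the density has a positive minimum.\<close>
  define s where "s = min e (dist p q)"
  have s: "s > 0" using e assms(3) by (auto simp: s_def)
  have "compact (cball p e)" "cball p e \<noteq> {}" using e by auto
  then obtain z0 where z0: "z0 \<in> cball p e" "\<And>z. z \<in> cball p e \<Longrightarrow> \<rho> z0 \<le> \<rho> z"
    using continuous_attains_inf[of "cball p e" \<rho>] continuous_on_subset[OF density_continuous e(2)]
    by blast
  have pos: "0 < \<rho> z0" using z0(1) e(2) density_pos by blast
  have "\<rho> z0 * s \<le> dst p q"
  proof (rule dst_geI[OF assms(1,2)])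
    fix \<gamma> assume \<gamma>: "\<gamma> \<in> paths p q"
    then have ends: "\<gamma> 0 = p" "\<gamma> 1 = q" by (auto simp: riem_paths_def pathstart_def pathfinish_def)
    obtain t0 t1 where t: "0 \<le> t0" "t0 \<le> t1" "t1 \<le> 1"
      "\<rho> z0 * (s - 0) \<le> integral {t0..t1} (speed \<gamma>)"
    proof (rule crossing_length[OF \<gamma>, of 0 1 p 0 s "\<rho> z0"])
      fix z assume "dist p z \<le> s" then show "\<rho> z0 \<le> \<rho> z" using z0(2)[of z] by (auto simp: s_def)
    qed (use ends s pos in \<open>auto simp: s_def\<close>)
    then show "\<rho> z0 * s \<le> integral {0..1} (speed \<gamma>)"
      using integral_speed_split[OF \<gamma>, of 0 t0 t1 1] integral_speed_nonneg[of 0 t0 \<gamma>] by auto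
  qed
  then show ?thesis using pos s by (smt (verit) mult_pos_pos)
qed

lemma Metric_space_dst: "Metric_space (ball 0 1) dst"
proof
  show nn: "0 \<le> dst p q" for p q
  proof (cases "p \<in> ball 0 1 \<and> q \<in> ball 0 1")
    case True then show ?thesis using dst_geI[of p q 0] integral_speed_nonneg by blast
  next
    case False then show ?thesis unfolding riem_dist_def by auto
  qed
  have le: "dst p q \<le> dst q p" for p q
  proof (cases "p \<in> ball 0 1 \<and> q \<in> ball 0 1")
    case True
    show ?thesis
      by (rule dst_geI) (use True dst_le_length reversepath_in_paths in \<open>fastforce+\<close>)
  next
    case False then show ?thesis unfolding riem_dist_def by auto
  qed
  show "dst p q = dst q p" for p q using le[of p q] le[of q p] by simp
  show "dst p q = 0 \<longleftrightarrow> p = q" if "p \<in> ball 0 1" "q \<in> ball 0 1" for p q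
  proof
    assume "p = q"
    have "dst q q \<le> \<rho> q * norm (q - q)"
      using dst_le_length[OF linepath_in_paths(1)[OF that(2) that(2)]]
        linepath_in_paths(2)[OF that(2) that(2), of "\<rho> q"] by force
    then show "dst p q = 0" using nn[of p q] \<open>p = q\<close> by simp
  qed (use dst_pos[OF that] in force)
  show "dst p r \<le> dst p q + dst q r" if pqr: "p \<in> ball 0 1" "q \<in> ball 0 1" "r \<in> ball 0 1" for p q r
  proof (rule field_le_epsilon)
    fix e :: real assume e: "0 < e"
    obtain g1 where g1: "g1 \<in> paths p q" "integral {0..1} (speed g1) < dst p q + e/2"
      using dst_approx[OF pqr(1,2), of "dst p q + e/2"] e by auto
    obtain g2 where g2: "g2 \<in> paths q r" "integral {0..1} (speed g2) < dst q r + e/2"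
      using dst_approx[OF pqr(2,3), of "dst q r + e/2"] e by auto
    show "dst p r \<le> dst p q + dst q r + e"
      using dst_le_length[OF joinpaths_in_paths(1)[OF g1(1) g2(1)]]
        joinpaths_in_paths(2)[OF g1(1) g2(1)] g1(2) g2(2) by linarith
  qed
qed

text \<open>A path from 0 to a point of norm at least \<open>s k\<close> crosses the annuli 0 to
  \<open>k\<close> one after another and pays \<open>L n\<close> in each. As these costs sum to
  infinity, a Cauchy sequence stays in a compact disk, where a Euclidean limit of a subsequence is
  also a limit for \<open>dst\<close>.\<close>

theorem complete_of_annuli:
  fixes r s L :: "nat \<Rightarrow> real"
  assumes rs: "\<And>n. 0 \<le> r n" "\<And>n. r n < s n" "\<And>n. s n \<le> r (Suc n)" "\<And>n. s n < 1"
    and L: "\<And>n. 0 < L n" "\<not> summable L"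
    and large: "\<And>n (z::complex). r n \<le> norm z \<Longrightarrow> norm z \<le> s n \<Longrightarrow> L n \<le> \<rho> z * (s n - r n)"
  shows "complete_riemannian (ball 0 1) (pullback_metric F)"
proof -
  interpret M: Metric_space "ball 0 1" dst by (rule Metric_space_dst)
  \<comment> \<open>The end time \<open>b\<close> varies in the induction: after the outermost
    crossing is cut off, the path up to \<open>t0\<close> ends on the circle of radius
    \<open>r (Suc k)\<close>, hence still beyond \<open>s k\<close>.\<close>
  have len: "(\<Sum>n\<le>k. L n) \<le> integral {0..b} (speed \<gamma>)"
    if \<gamma>: "\<gamma> \<in> paths 0 q" and b: "0 \<le> b" "b \<le> 1" "s k \<le> norm (\<gamma> b)" for \<gamma> q k b
    using b
  proof (induction k arbitrary: b)
    case 0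
    have \<gamma>0: "\<gamma> 0 = 0" using \<gamma> by (auto simp: riem_paths_def pathstart_def)
    obtain t0 t1 where t: "0 \<le> t0" "t0 \<le> t1" "t1 \<le> b"
      "L 0 / (s 0 - r 0) * (s 0 - r 0) \<le> integral {t0..t1} (speed \<gamma>)"
    proof (rule crossing_length[OF \<gamma>, of 0 b 0 "r 0" "s 0" "L 0 / (s 0 - r 0)"])
      fix z :: complex assume "r 0 \<le> dist 0 z" "dist 0 z \<le> s 0"
      then show "L 0 / (s 0 - r 0) \<le> \<rho> z"
        using large[of 0 z] rs(2)[of 0] by (simp add: pos_divide_le_eq)
    qed (use 0 \<gamma>0 rs(1,2)[of 0] L(1)[of 0] in auto)
    then show ?case using integral_speed_split[OF \<gamma>, of 0 t0 t1 b] 0 integral_speed_nonneg[of 0 t0 \<gamma>] rs(2)[of 0]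
      by auto
  next
    case (Suc k)
    have \<gamma>0: "\<gamma> 0 = 0" using \<gamma> by (auto simp: riem_paths_def pathstart_def)
    obtain t0 t1 where t: "0 \<le> t0" "t0 \<le> t1" "t1 \<le> b" "r (Suc k) = dist 0 (\<gamma> t0)"
      "L (Suc k) / (s (Suc k) - r (Suc k)) * (s (Suc k) - r (Suc k)) \<le> integral {t0..t1} (speed \<gamma>)"
    proof (rule crossing_length[OF \<gamma>, of 0 b 0 "r (Suc k)" "s (Suc k)" "L (Suc k) / (s (Suc k) - r (Suc k))"])
      fix z :: complex assume "r (Suc k) \<le> dist 0 z" "dist 0 z \<le> s (Suc k)"
      then show "L (Suc k) / (s (Suc k) - r (Suc k)) \<le> \<rho> z"
        using large[of "Suc k" z] rs(2)[of "Suc k"] by (simp add: pos_divide_le_eq)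
    qed (use Suc.prems \<gamma>0 rs(1,2)[of "Suc k"] L(1)[of "Suc k"] in auto)
    have "(\<Sum>n\<le>k. L n) \<le> integral {0..t0} (speed \<gamma>)"
      using Suc.IH[of t0] t Suc.prems rs(3)[of k] by auto
    then show ?case using integral_speed_split[OF \<gamma>, of 0 t0 t1 b] Suc.prems t rs(2)[of "Suc k"]
      by auto
  qed
  have far: "(\<Sum>n\<le>k. L n) \<le> dst 0 z" if "z \<in> ball 0 1" "s k \<le> norm z" for k z
  proof (rule dst_geI)
    fix \<gamma> assume \<gamma>: "\<gamma> \<in> paths 0 z"
    then have "\<gamma> 1 = z" by (auto simp: riem_paths_def pathfinish_def)
    then show "(\<Sum>n\<le>k. L n) \<le> integral {0..1} (speed \<gamma>)" using len[OF \<gamma>, of 1 k] that by auto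
  qed (use that in auto)
  have "M.mcomplete"
    unfolding M.mcomplete_def
  proof (intro allI impI)
    fix \<sigma> assume C: "M.MCauchy \<sigma>"
    then have ran: "\<sigma> n \<in> ball 0 1" for n unfolding M.MCauchy_def by blast
    obtain N where N: "\<And>n n'. N \<le> n \<Longrightarrow> N \<le> n' \<Longrightarrow> dst (\<sigma> n) (\<sigma> n') < 1"
      using C unfolding M.MCauchy_def by (metis zero_less_one)
    obtain k where k: "dst 0 (\<sigma> N) + 1 < (\<Sum>n\<le>k. L n)"
    proof (rule ccontr)
      assume "\<not> thesis"
      then have "(\<Sum>n\<le>k. L n) \<le> dst 0 (\<sigma> N) + 1" for k using that[of k] by (metis not_le)
      then have "summable L"
        by (intro bounded_imp_summable[where B = "dst 0 (\<sigma> N) + 1"]) (auto intro: less_imp_le L)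
      then show False using L by simp
    qed
    \<comment> \<open>Beyond radius \<open>s k\<close> the distance from 0 exceeds
      \<open>dst 0 (\<sigma> N) + 1\<close>, but the tail stays within distance 1 of
      \<open>\<sigma> N\<close>.\<close>
    have inb: "\<sigma> (n + N) \<in> cball 0 (s k)" for n
    proof (rule ccontr)
      assume "\<sigma> (n + N) \<notin> cball 0 (s k)"
      then have "(\<Sum>n\<le>k. L n) \<le> dst 0 (\<sigma> (n + N))" using far[OF ran] by auto
      also have "\<dots> \<le> dst 0 (\<sigma> N) + dst (\<sigma> N) (\<sigma> (n + N))" using ran by (intro M.triangle) auto
      also have "\<dots> < dst 0 (\<sigma> N) + 1" using N[of N "n + N"] by auto
      finally show False using k by simp
    qed
    have "seq_compact (cball (0::complex) (s k))" by (simp add: compact_imp_seq_compact)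
    then obtain l h where l: "l \<in> cball 0 (s k)" and h: "strict_mono h"
      and lim: "((\<lambda>n. \<sigma> (n + N)) \<circ> h) \<longlonglongrightarrow> l"
      using seq_compactE[of "cball 0 (s k)" "\<lambda>n. \<sigma> (n + N)"] inb by blast
    have sub: "cball 0 (s k) \<subseteq> ball (0::complex) 1" using rs(4)[of k] by auto
    have "compact (\<rho> ` cball 0 (s k))"
      using continuous_on_subset[OF density_continuous sub] by (intro compact_continuous_image) auto
    then have "bdd_above (\<rho> ` cball 0 (s k))"
      by (intro bounded_imp_bdd_above compact_imp_bounded)
    then obtain K where K: "\<And>z. z \<in> cball 0 (s k) \<Longrightarrow> \<rho> z \<le> K"
      unfolding bdd_above_def by blast
    define h' where "h' = (\<lambda>n. h n + N)"
    have h': "strict_mono h'" using h by (auto simp: h'_def strict_mono_def)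
    have lim': "(\<lambda>n. \<sigma> (h' n)) \<longlonglongrightarrow> l" using lim by (simp add: h'_def o_def)
    have bd: "dst (\<sigma> (h' n)) l \<le> K * norm (l - \<sigma> (h' n))" for n
    proof -
      have "closed_segment (\<sigma> (h' n)) l \<subseteq> cball 0 (s k)"
        using inb[of "h n"] l by (intro closed_segment_subset) (auto simp: h'_def)
      then have "integral {0..1} (speed (linepath (\<sigma> (h' n)) l)) \<le> K * norm (l - \<sigma> (h' n))"
        using linepath_in_paths(2)[OF ran[of "h' n"], of l K] K l sub by blast
      then show ?thesis
        using dst_le_length[OF linepath_in_paths(1)[OF ran[of "h' n"], of l]] l sub by force
    qed
    have "(\<lambda>n. K * norm (l - \<sigma> (h' n))) \<longlonglongrightarrow> K * norm (l - l)"
      by (intro tendsto_intros lim')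
    then have null: "(\<lambda>n. K * norm (l - \<sigma> (h' n))) \<longlonglongrightarrow> 0" by simp
    have "(\<lambda>n. dst (\<sigma> (h' n)) l) \<longlonglongrightarrow> 0"
      by (rule Lim_null_comparison[OF always_eventually null]) (simp add: bd)
    then have "\<forall>e>0. \<forall>\<^sub>F n in sequentially. dst (\<sigma> (h' n)) l < e"
      by (auto intro: order_tendstoD(2))
    then have "limitin M.mtopology (\<sigma> \<circ> h') l sequentially"
      unfolding M.limitin_metric using l sub ran by (auto simp: o_def subset_eq)
    then show "\<exists>x. limitin M.mtopology \<sigma> x sequentially"
      using M.MCauchy_convergent_subsequence[OF C h'] by blast
  qed
  then show ?thesis
    unfolding complete_riemannian_def using Metric_space_dst by blast
qed

end

section \<open>Perturbing polynomial Legendrian curves\<close>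

text \<open>Only values on the unit circle matter, where \<open>cnj z = inverse z\<close>: multiplying a trigonometric
  polynomial by a high power of \<open>z\<close> gives a function that extends holomorphically to the disk.\<close>

definition trig_poly :: "(complex \<Rightarrow> complex) \<Rightarrow> bool" where
  "trig_poly f \<longleftrightarrow> (\<exists>k p. \<forall>z. norm z = 1 \<longrightarrow> z ^ k * f z = poly p z)"

section \<open>Trigonometric polynomials, and estimates on the closed disk\<close>

lemma trig_poly_poly: "trig_poly (poly p)"
  unfolding trig_poly_def by (rule exI[of _ 0]) auto

lemma trig_poly_const: "trig_poly (\<lambda>z. c)"
  using trig_poly_poly[of "[:c:]"] by (simp add: trig_poly_def)

lemma trig_poly_add:
  assumes "trig_poly f" "trig_poly g"
  shows "trig_poly (\<lambda>z. f z + g z)"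
proof -
  obtain k p l q where k: "\<And>z. norm z = 1 \<Longrightarrow> z ^ k * f z = poly p z"
    and l: "\<And>z. norm z = 1 \<Longrightarrow> z ^ l * g z = poly q z"
    using assms unfolding trig_poly_def by blast
  have "z ^ (k + l) * (f z + g z) = poly (monom 1 l * p + monom 1 k * q) z" if "norm z = 1" for z
    using k[OF that, symmetric] l[OF that, symmetric] by (simp add: poly_monom power_add algebra_simps)
  then show ?thesis unfolding trig_poly_def by blast
qed

lemma trig_poly_mult:
  assumes "trig_poly f" "trig_poly g"
  shows "trig_poly (\<lambda>z. f z * g z)"
proof -
  obtain k p l q where k: "\<And>z. norm z = 1 \<Longrightarrow> z ^ k * f z = poly p z"
    and l: "\<And>z. norm z = 1 \<Longrightarrow> z ^ l * g z = poly q z"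
    using assms unfolding trig_poly_def by blast
  have "z ^ (k + l) * (f z * g z) = poly (p * q) z" if "norm z = 1" for z
    using k[OF that, symmetric] l[OF that, symmetric] by (simp add: power_add algebra_simps)
  then show ?thesis unfolding trig_poly_def by blast
qed

lemma trig_poly_cnj_poly: "trig_poly (\<lambda>z. cnj (poly p z))"
proof (induction p)
  case 0
  then show ?case using trig_poly_const[of 0] by simp
next
  case (pCons a p)
  \<comment> \<open>Conjugation itself is the base case, because \<open>z * cnj z = 1\<close> on the
    circle; sums and products then give every conjugated polynomial.\<close>
  have "z ^ 1 * cnj z = poly [:1:] z" if "norm z = 1" for z :: complex
    using that by (simp add: complex_norm_square[symmetric] flip: of_real_power)
  then have "trig_poly cnj" unfolding trig_poly_def by blast
  then show ?case
    using trig_poly_add[OF trig_poly_const[of "cnj a"] trig_poly_mult[OF _ pCons(2)]] by simp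
qed

text \<open>Termwise integration divides the coefficient of index \<open>i\<close> by
  \<open>K + i + 1\<close>. The constant depends on \<open>c\<close> alone, so \<open>K\<close> can
  be chosen after it; this is the gain from rapid oscillation.\<close>

lemma primitive_monom_mult_bound:
  fixes c :: "complex poly"
  obtains C where "0 \<le> C"
    "\<And>K. \<exists>q. pderiv q = monom 1 K * c \<and> (\<forall>z. norm z \<le> 1 \<longrightarrow> norm (poly q z) \<le> C / (real K + 1))"
proof -
  let ?C = "\<Sum>i\<le>degree c. norm (coeff c i)"
  have "\<exists>q. pderiv q = monom 1 K * c \<and> (\<forall>z. norm z \<le> 1 \<longrightarrow> norm (poly q z) \<le> ?C / (real K + 1))" for K
  proof (intro exI conjI allI impI)
    define q where "q = (\<Sum>i\<le>degree c. monom (coeff c i / of_nat (K + i + 1)) (K + i + 1))"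
    have "of_nat (K + i + 1) \<noteq> (0 :: complex)" for i by (metis of_nat_neq_0 Suc_eq_plus1)
    then have "pderiv q = (\<Sum>i\<le>degree c. monom (coeff c i) (K + i))"
      unfolding q_def higher_pderiv_sum[of 1, simplified] pderiv_monom by (intro sum.cong refl) simp
    also have "\<dots> = monom 1 K * (\<Sum>i\<le>degree c. monom (coeff c i) i)"
      by (simp add: sum_distrib_left mult_monom)
    finally show "pderiv q = monom 1 K * c" by (simp add: poly_as_sum_of_monoms)
    fix z :: complex assume z: "norm z \<le> 1"
    have "norm (poly q z) \<le> (\<Sum>i\<le>degree c. norm (coeff c i) / (real K + 1))"
      unfolding q_def poly_sum
    proof (rule order_trans[OF norm_sum sum_mono])
      fix i
      have "norm (poly (monom (coeff c i / of_nat (K + i + 1)) (K + i + 1)) z)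
          = norm (coeff c i) / real (K + i + 1) * norm z ^ (K + i + 1)"
        by (simp only: poly_monom norm_mult norm_divide norm_power norm_of_nat)
      also have "\<dots> \<le> norm (coeff c i) / real (K + i + 1) * 1"
        using z by (intro mult_left_mono power_le_one) auto
      also have "\<dots> \<le> norm (coeff c i) / (real K + 1)"
        by (simp add: frac_le)
      finally show "norm (poly (monom (coeff c i / of_nat (K + i + 1)) (K + i + 1)) z)
          \<le> norm (coeff c i) / (real K + 1)" .
    qed
    also have "\<dots> = ?C / (real K + 1)" by (simp add: sum_divide_distrib)
    finally show "norm (poly q z) \<le> ?C / (real K + 1)" .
  qed
  then show thesis using that[of ?C] by (auto simp: sum_nonneg)
qed

lemma poly_bounded_on_disk:
  fixes p :: "complex poly"
  obtains C where "0 \<le> C" "\<And>z. norm z \<le> 1 \<Longrightarrow> norm (poly p z) \<le> C"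
proof -
  have "compact (poly p ` cball 0 1)" by (intro compact_continuous_image continuous_intros) auto
  then have "bounded (poly p ` cball 0 1)" by (rule compact_imp_bounded)
  then obtain C where "\<forall>z\<in>cball 0 1. norm (poly p z) \<le> C" unfolding bounded_iff by blast
  then have "norm (poly p z) \<le> max C 0" if "norm z \<le> 1" for z using that by (simp add: le_max_iff_disj)
  then show thesis using that[of "max C 0"] by simp
qed

section \<open>The potential and its first variation\<close>

definition potential :: "complex \<Rightarrow> complex \<Rightarrow> complex \<Rightarrow> real" where
  "potential u m w = (Re u)\<^sup>2 + (Re w)\<^sup>2 + (norm (m - \<i>))\<^sup>2"

lemma potential_bounds:
  assumes "potential u m w \<le> 1"
  shows "\<bar>Re u\<bar> \<le> 1" "\<bar>Re w\<bar> \<le> 1" "norm (m - \<i>) \<le> 1"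
proof -
  have "(Re u)\<^sup>2 \<le> 1" "(Re w)\<^sup>2 \<le> 1" "(norm (m - \<i>))\<^sup>2 \<le> 1"
    using assms unfolding potential_def by (smt (verit) zero_le_power2)+
  then show "\<bar>Re u\<bar> \<le> 1" "\<bar>Re w\<bar> \<le> 1" "norm (m - \<i>) \<le> 1"
    using abs_le_square_iff[of _ 1] by (force simp: power2_le_iff_abs_le)+
qed

text \<open>If \<open>dw = m du\<close>, the potential has differential \<open>2 Re (A du + B dm)\<close>, which vanishes on the
  direction \<open>(du, dm) = \<epsilon> t (-B, A)\<close>; so a step of length \<open>\<epsilon>\<close> costs only \<open>O(\<epsilon>\<^sup>2)\<close>.\<close>

lemma potential_change:
  fixes u m w t E :: complex and \<epsilon> :: real
  defines "A \<equiv> of_real (Re u) + m * of_real (Re w)" and "B \<equiv> cnj (m - \<i>)"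
  assumes t: "norm t = 1" and \<epsilon>: "0 < \<epsilon>" "\<epsilon> \<le> 1" and E: "norm E \<le> \<epsilon>\<^sup>2"
    and le1: "potential u m w \<le> 1"
  shows "\<bar>potential (u - \<epsilon> * (t * B)) (m + \<epsilon> * (t * A))
            (w - \<epsilon> * (t * m * B) - (complex_of_real \<epsilon>)\<^sup>2 / 2 * (t\<^sup>2 * A * B) + E) - potential u m w\<bar> \<le> 36 * \<epsilon>\<^sup>2"
proof -
  define du where "du = - \<epsilon> * (t * B)"
  define dm where "dm = \<epsilon> * (t * A)"
  define e2 where "e2 = E - (complex_of_real \<epsilon>)\<^sup>2 / 2 * (t\<^sup>2 * A * B)"
  define dw where "dw = - \<epsilon> * (t * m * B) + e2"
  note bd = potential_bounds[OF le1]
  have m2: "norm m \<le> 2" using bd(3) norm_triangle_ineq4[of "m - \<i>" "- \<i>"] by simp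
  have B1: "norm B \<le> 1" unfolding B_def using bd(3) by (metis complex_mod_cnj)
  have A3: "norm A \<le> 3"
  proof -
    have "norm A \<le> \<bar>Re u\<bar> + norm m * \<bar>Re w\<bar>"
      unfolding A_def by (rule order_trans[OF norm_triangle_ineq]) (simp add: norm_mult)
    also have "\<dots> \<le> 1 + 2 * 1" using bd m2 by (intro add_mono mult_mono) auto
    finally show ?thesis by simp
  qed
  have AB: "norm (A * B) \<le> 3" using mult_mono[OF A3 B1] by (simp add: norm_mult)
  have e2: "norm e2 \<le> 5 / 2 * \<epsilon>\<^sup>2"
  proof -
    have "norm e2 \<le> norm E + \<epsilon>\<^sup>2 / 2 * norm (A * B)"
      unfolding e2_def
      by (rule order_trans[OF norm_triangle_ineq4]) (use t in \<open>simp add: norm_mult norm_power norm_divide\<close>)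
    also have "\<dots> \<le> \<epsilon>\<^sup>2 + \<epsilon>\<^sup>2 / 2 * 3" using E AB by (intro add_mono mult_left_mono) auto
    finally show ?thesis by simp
  qed
  have du: "norm du \<le> \<epsilon>" using B1 t \<epsilon> by (simp add: du_def norm_mult)
  have dm: "norm dm \<le> 3 * \<epsilon>" using A3 t \<epsilon> by (simp add: dm_def norm_mult)
  have dw: "norm dw \<le> 9 / 2 * \<epsilon>"
  proof -
    have "norm dw \<le> \<epsilon> * (norm m * norm B) + norm e2"
      unfolding dw_def by (rule order_trans[OF norm_triangle_ineq]) (use t \<epsilon> in \<open>simp add: norm_mult\<close>)
    also have "\<dots> \<le> \<epsilon> * (2 * 1) + 5 / 2 * \<epsilon>\<^sup>2"
      using e2 m2 B1 \<epsilon> by (intro add_mono mult_mono mult_left_mono) auto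
    also have "\<epsilon>\<^sup>2 \<le> \<epsilon>" using \<epsilon> by (simp add: power2_eq_square mult_left_le)
    finally show ?thesis by simp
  qed
  \<comment> \<open>The first-order terms cancel even before the real part is taken:
    \<open>B * dm\<close> contributes \<open>\<epsilon> t A B\<close>, and the other two together
    contribute its negative.\<close>
  have lin: "Re u * Re du + Re w * Re (- \<epsilon> * (t * m * B)) + Re (B * dm) = 0"
  proof -
    have "Re u * Re du + Re w * Re (- \<epsilon> * (t * m * B)) + Re (B * dm)
        = Re (of_real (Re u) * du + of_real (Re w) * (- \<epsilon> * (t * m * B)) + B * dm)" by simp
    also have "of_real (Re u) * du + of_real (Re w) * (- \<epsilon> * (t * m * B)) + B * dm = 0"
      by (simp add: du_def dm_def A_def algebra_simps)
    finally show ?thesis by simp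
  qed
  have cross: "(norm (m + dm - \<i>))\<^sup>2 = (norm (m - \<i>))\<^sup>2 + 2 * Re (B * dm) + (norm dm)\<^sup>2"
    unfolding B_def cmod_power2 by (simp add: power2_eq_square algebra_simps)
  have "potential (u + du) (m + dm) (w + dw) - potential u m w
      = 2 * (Re u * Re du + Re w * Re dw + Re (B * dm)) + (Re du)\<^sup>2 + (Re dw)\<^sup>2 + (norm dm)\<^sup>2"
    unfolding potential_def cross by (simp add: power2_eq_square algebra_simps)
  also have "Re u * Re du + Re w * Re dw + Re (B * dm) = Re w * Re e2"
    using lin by (simp add: dw_def algebra_simps)
  finally have eq: "potential (u + du) (m + dm) (w + dw) - potential u m w
      = 2 * (Re w * Re e2) + (Re du)\<^sup>2 + (Re dw)\<^sup>2 + (norm dm)\<^sup>2" .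
  have "\<bar>Re w * Re e2\<bar> \<le> 1 * (5 / 2 * \<epsilon>\<^sup>2)"
    unfolding abs_mult using bd(2) e2 abs_Re_le_cmod[of e2] by (intro mult_mono) auto
  moreover have "(Re du)\<^sup>2 \<le> \<epsilon>\<^sup>2"
    using power_mono[of "\<bar>Re du\<bar>" \<epsilon> 2] du abs_Re_le_cmod[of du] by simp
  moreover have "(Re dw)\<^sup>2 \<le> 81 / 4 * \<epsilon>\<^sup>2"
    using power_mono[of "\<bar>Re dw\<bar>" "9 / 2 * \<epsilon>" 2] dw abs_Re_le_cmod[of dw]
    by (simp add: power_mult_distrib power_divide)
  moreover have "(norm dm)\<^sup>2 \<le> 9 * \<epsilon>\<^sup>2"
    using power_mono[of "norm dm" "3 * \<epsilon>" 2] dm by (simp add: power_mult_distrib)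
  moreover have "0 \<le> \<epsilon>\<^sup>2" "0 \<le> (Re du)\<^sup>2" "0 \<le> (Re dw)\<^sup>2" "0 \<le> (norm dm)\<^sup>2" by auto
  \<comment> \<open>The four bounds add up to 5 + 1 + 81/4 + 9 = 35.25 times
    \<open>\<epsilon>\<^sup>2\<close>.\<close>
  ultimately have "\<bar>potential (u + du) (m + dm) (w + dw) - potential u m w\<bar> \<le> 36 * \<epsilon>\<^sup>2"
    unfolding eq by (intro abs_leI) linarith+
  then show ?thesis
    by (simp add: du_def dm_def dw_def e2_def algebra_simps)
qed

text \<open>If both terms are small, then \<open>m\<close> is close to \<open>\<i>\<close>, so the
  imaginary part of the first term is nearly \<open>Re w\<close> and its real part nearly
  \<open>Re u\<close>. Both are at most 1/7, and the potential is at most 2/49 + 1/64, below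
  1/4.\<close>

lemma direction_lower_bound:
  fixes u m w :: complex
  assumes "1 / 4 \<le> potential u m w"
  shows "1 / 8 \<le> norm (of_real (Re u) + m * of_real (Re w)) + norm (cnj (m - \<i>))"
proof (rule ccontr)
  let ?A = "of_real (Re u) + m * of_real (Re w)"
  assume "\<not> ?thesis"
  then have small: "norm ?A < 1 / 8" "norm (m - \<i>) < 1 / 8"
    using norm_ge_zero[of ?A] norm_ge_zero[of "cnj (m - \<i>)"] unfolding complex_mod_cnj by linarith+
  have im: "\<bar>Im m - 1\<bar> < 1 / 8" and re: "\<bar>Re m\<bar> < 1 / 8"
    using small(2) abs_Im_le_cmod[of "m - \<i>"] abs_Re_le_cmod[of "m - \<i>"] by auto
  have "\<bar>Im m * Re w\<bar> < 1 / 8" "\<bar>Re u + Re m * Re w\<bar> < 1 / 8"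
    using small(1) abs_Im_le_cmod[of ?A] abs_Re_le_cmod[of ?A] by auto
  moreover have "7 / 8 * \<bar>Re w\<bar> \<le> \<bar>Im m * Re w\<bar>"
    unfolding abs_mult by (intro mult_right_mono) (use im in linarith, simp)
  ultimately have w: "\<bar>Re w\<bar> \<le> 1 / 7" by linarith
  have "\<bar>Re m * Re w\<bar> \<le> 1 / 8 * (1 / 7)" unfolding abs_mult using re w by (intro mult_mono) auto
  then have u: "\<bar>Re u\<bar> \<le> 1 / 7" using \<open>\<bar>Re u + Re m * Re w\<bar> < 1 / 8\<close> by linarith
  have "(Re u)\<^sup>2 \<le> (1 / 7)\<^sup>2" "(Re w)\<^sup>2 \<le> (1 / 7)\<^sup>2" "(norm (m - \<i>))\<^sup>2 \<le> (1 / 8)\<^sup>2"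
    using u w small(2) power_mono[of "\<bar>Re u\<bar>" "1/7" 2] power_mono[of "\<bar>Re w\<bar>" "1/7" 2]
      power_mono[of "norm (m - \<i>)" "1/8" 2] by (auto simp only: power2_abs abs_ge_zero norm_ge_zero less_imp_le)
  then show False using assms unfolding potential_def by (simp add: power2_eq_square)
qed

section \<open>One perturbation step\<close>

lemma circle_direction_polys:
  fixes u m w :: "complex poly"
  obtains a k b where
    "\<And>z. norm z = 1 \<Longrightarrow> poly a z =
        z ^ k * (of_real (Re (poly u z)) + poly m z * of_real (Re (poly w z)))"
    "\<And>z. norm z = 1 \<Longrightarrow> poly b z = z ^ k * cnj (poly m z - \<i>)"
proof -
  have re: "trig_poly (\<lambda>z. of_real (Re (poly p z)))" for p
  proof -
    have "(\<lambda>z. of_real (Re (poly p z))) = (\<lambda>z. (1 / 2) * (poly p z + cnj (poly p z)))"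
      by (auto simp: complex_add_cnj)
    then show ?thesis
      using trig_poly_mult[OF trig_poly_const[of "1 / 2"] trig_poly_add[OF trig_poly_poly[of p] trig_poly_cnj_poly[of p]]]
      by simp
  qed
  obtain k1 a where a: "\<And>z. norm z = 1 \<Longrightarrow>
      z ^ k1 * (of_real (Re (poly u z)) + poly m z * of_real (Re (poly w z))) = poly a z"
    using trig_poly_add[OF re[of u] trig_poly_mult[OF trig_poly_poly[of m] re[of w]]]
    unfolding trig_poly_def by blast
  obtain k2 b where b: "\<And>z. norm z = 1 \<Longrightarrow> z ^ k2 * cnj (poly m z - \<i>) = poly b z"
    using trig_poly_cnj_poly[of "m - [:\<i>:]"] unfolding trig_poly_def by (auto simp: poly_diff)
  show thesis
  \<comment> \<open>Both coefficients need the same power of \<open>z\<close>, because the same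
    unimodular factor must multiply them for the first variation to cancel.\<close>
  proof (rule that[of "monom 1 k2 * a" "k1 + k2" "monom 1 k1 * b"])
    fix z :: complex assume z: "norm z = 1"
    show "poly (monom 1 k2 * a) z =
        z ^ (k1 + k2) * (of_real (Re (poly u z)) + poly m z * of_real (Re (poly w z)))"
      unfolding poly_mult a[OF z, symmetric] by (simp add: poly_monom power_add algebra_simps)
    show "poly (monom 1 k1 * b) z = z ^ (k1 + k2) * cnj (poly m z - \<i>)"
      unfolding poly_mult b[OF z, symmetric] by (simp add: poly_monom power_add algebra_simps)
  qed
qed

text \<open>Each \<open>z\<close> near the circle is compared with its radial projection
  \<open>sgn z\<close>; uniform continuity makes the width of the annulus independent of the
  direction. The 1/2 in the radius only keeps \<open>z\<close> away from 0.\<close>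

lemma lower_bound_near_circle:
  fixes f :: "complex \<Rightarrow> real"
  assumes "continuous_on (cball 0 1) f" "c' < c" "\<And>z. norm z = 1 \<Longrightarrow> c \<le> f z"
  obtains r where "r < 1" "\<And>z. r \<le> norm z \<Longrightarrow> norm z \<le> 1 \<Longrightarrow> c' \<le> f z"
proof -
  have "uniformly_continuous_on (cball 0 1) f"
    using assms(1) by (intro compact_uniformly_continuous) auto
  then obtain d where d: "0 < d"
    "\<And>x y. x \<in> cball 0 1 \<Longrightarrow> y \<in> cball 0 1 \<Longrightarrow> dist y x < d \<Longrightarrow> dist (f y) (f x) < c - c'"
    using assms(2) unfolding uniformly_continuous_on_def by (metis diff_gt_0_iff_gt)
  show thesis
  proof (rule that[of "max (1 / 2) (1 - d / 2)"])
    fix z :: complex assume z: "max (1 / 2) (1 - d / 2) \<le> norm z" "norm z \<le> 1"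
    then have z0: "z \<noteq> 0" by auto
    have "z - sgn z = of_real (norm z - 1) * sgn z"
      using z0 by (simp add: sgn_eq field_simps)
    then have "dist z (sgn z) = 1 - norm z"
      using z z0 by (simp add: dist_norm norm_mult norm_sgn flip: of_real_diff)
    then have "dist (f z) (f (sgn z)) < c - c'"
      using d z z0 by (intro d(2)) (auto simp: norm_sgn)
    moreover have "c \<le> f (sgn z)" using assms(3) z0 by (simp add: norm_sgn)
    ultimately show "c' \<le> f z" by (simp add: dist_real_def abs_less_iff)
  qed (use d in auto)
qed

text \<open>Integration by parts moves the derivative off the rapidly oscillating factor \<open>z ^ M\<close>, except in
  the products that are exact derivatives; the remaining primitives are the error \<open>E\<close>.\<close>

lemma perturbed_primitive:
  fixes u m w a b :: "complex poly"
  assumes "pderiv w = m * pderiv u"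
  obtains C where "0 \<le> C"
    "\<And>M \<epsilon>. (0::real) < \<epsilon> \<Longrightarrow> \<epsilon> \<le> (1::real) \<Longrightarrow> \<exists>w1 E.
        pderiv w1 = (m + smult \<epsilon> (monom 1 M * a)) * pderiv (u - smult \<epsilon> (monom 1 M * b)) \<and>
        (\<forall>z. poly w1 z = poly w z - \<epsilon> * (z ^ M * poly m z * poly b z)
               - (complex_of_real \<epsilon>)\<^sup>2 / 2 * ((z ^ M)\<^sup>2 * poly a z * poly b z) + E z) \<and>
        (\<forall>z. norm z \<le> 1 \<longrightarrow> norm (E z) \<le> C / (real M + 1))"
proof -
  \<comment> \<open>With \<open>X = z ^ M\<close>, the term \<open>-m (X b)'\<close> is
    \<open>-(X m b)' + X b m'\<close>, and \<open>X a (X b)'\<close> is half of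
    \<open>(X X a b)'\<close> plus half of \<open>X X (a b' - a' b)\<close>. Together with
    \<open>X a u'\<close>, what remains to be integrated is \<open>X c1\<close> and half of
    \<open>X X c3\<close>, where \<open>X\<close> is no longer differentiated.\<close>
  define c1 where "c1 = b * pderiv m + a * pderiv u"
  define c3 where "c3 = pderiv a * b - a * pderiv b"
  obtain C1 where C1: "0 \<le> C1" "\<And>K. \<exists>q. pderiv q = monom 1 K * c1 \<and>
      (\<forall>z. norm z \<le> 1 \<longrightarrow> norm (poly q z) \<le> C1 / (real K + 1))"
    by (rule primitive_monom_mult_bound[of c1]) blast
  obtain C3 where C3: "0 \<le> C3" "\<And>K. \<exists>q. pderiv q = monom 1 K * c3 \<and>
      (\<forall>z. norm z \<le> 1 \<longrightarrow> norm (poly q z) \<le> C3 / (real K + 1))"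
    by (rule primitive_monom_mult_bound[of c3]) blast
  show thesis
  proof (rule that[of "C1 + C3"])
    fix M :: nat and \<epsilon> :: real assume \<epsilon>: "0 < \<epsilon>" "\<epsilon> \<le> 1"
    obtain q1 where q1: "pderiv q1 = monom 1 M * c1"
      "\<And>z. norm z \<le> 1 \<Longrightarrow> norm (poly q1 z) \<le> C1 / (real M + 1)" using C1(2)[of M] by blast
    obtain q3 where q3: "pderiv q3 = monom 1 (2 * M) * c3"
      "\<And>z. norm z \<le> 1 \<Longrightarrow> norm (poly q3 z) \<le> C3 / (real (2 * M) + 1)" using C3(2)[of "2 * M"] by blast
    define X :: "complex poly" where "X = monom 1 M"
    define e where "e = [:complex_of_real \<epsilon>:]"
    \<comment> \<open>Scalars become constant polynomials, and one half enters only through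
      \<open>h + h = 1\<close>, so that the derivative identity is a pure ring identity for
      \<open>algebra\<close>.\<close>
    define h where "h = [:1 / 2 :: complex:]"
    have XX: "monom 1 (2 * M) = X * X" by (simp add: X_def mult_monom mult_2)
    have hh: "h + h = 1" by (simp add: h_def one_pCons)
    have de: "pderiv e = 0" "pderiv h = 0" by (simp_all add: e_def h_def pderiv_pCons)
    have sm: "smult (complex_of_real \<epsilon>) p = e * p" for p by (simp add: e_def)
    define w1 where "w1 = w - e * (X * m * b) - h * e * e * (X * X * a * b) + (e * q1 + h * e * e * q3)"
    define E where "E z = poly (e * q1 + h * e * e * q3) z" for z
    have "pderiv w1 = (m + smult \<epsilon> (monom 1 M * a)) * pderiv (u - smult \<epsilon> (monom 1 M * b))"
      unfolding w1_def sm X_def[symmetric]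
      apply (simp only: pderiv_add pderiv_diff pderiv_mult de q1(1) q3(1) XX X_def[symmetric] c1_def c3_def assms)
      using hh by algebra
    moreover have "poly w1 z = poly w z - \<epsilon> * (z ^ M * poly m z * poly b z)
               - (complex_of_real \<epsilon>)\<^sup>2 / 2 * ((z ^ M)\<^sup>2 * poly a z * poly b z) + E z" for z
      unfolding w1_def E_def
      by (simp add: e_def h_def X_def poly_monom power2_eq_square)
    moreover have "norm (E z) \<le> (C1 + C3) / (real M + 1)" if "norm z \<le> 1" for z
    proof -
      have "norm (E z) \<le> \<epsilon> * norm (poly q1 z) + \<epsilon>\<^sup>2 / 2 * norm (poly q3 z)"
        unfolding E_def poly_add
        by (rule order_trans[OF norm_triangle_ineq])
           (use \<epsilon> in \<open>simp add: e_def h_def norm_mult power2_eq_square\<close>)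
      also have "\<dots> \<le> 1 * (C1 / (real M + 1)) + 1 * (C3 / (real (2 * M) + 1))"
        using \<epsilon> q1(2)[OF that] q3(2)[OF that] power_le_one[of \<epsilon> 2] by (intro add_mono mult_mono) auto
      also have "C3 / (real (2 * M) + 1) \<le> C3 / (real M + 1)"
        using C3(1) by (intro divide_left_mono) auto
      finally show ?thesis by (simp add: add_divide_distrib)
    qed
    ultimately show "\<exists>w1 E.
        pderiv w1 = (m + smult \<epsilon> (monom 1 M * a)) * pderiv (u - smult \<epsilon> (monom 1 M * b)) \<and>
        (\<forall>z. poly w1 z = poly w z - \<epsilon> * (z ^ M * poly m z * poly b z)
               - (complex_of_real \<epsilon>)\<^sup>2 / 2 * ((z ^ M)\<^sup>2 * poly a z * poly b z) + E z) \<and>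
        (\<forall>z. norm z \<le> 1 \<longrightarrow> norm (E z) \<le> (C1 + C3) / (real M + 1))"
      by blast
  qed (use C1(1) C3(1) in simp)
qed

lemma poly_pderiv_monom_mult:
  "poly (pderiv (monom 1 M * p)) z = of_nat M * z ^ (M - 1) * poly p z + z ^ M * poly (pderiv p) z"
  by (simp add: pderiv_mult pderiv_monom poly_monom algebra_simps)

text \<open>Only the exponent \<open>M\<close> is chosen at the end. On the disk of radius
  \<open>R\<close> the change and its derivatives tend to 0 with \<open>M R ^ M\<close> and
  \<open>1 / M\<close>. Near the circle the derivatives grow like \<open>\<epsilon> M\<close>, which
  an annulus of width \<open>1 / (4 M)\<close> turns into a length of order
  \<open>\<epsilon>\<close>.\<close>

lemma perturbation_step:
  fixes u m w :: "complex poly" and \<epsilon> R \<eta> :: real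
  assumes w: "pderiv w = m * pderiv u"
    and pot: "\<And>z. norm z = 1 \<Longrightarrow> 1 / 4 \<le> potential (poly u z) (poly m z) (poly w z)"
      "\<And>z. norm z = 1 \<Longrightarrow> potential (poly u z) (poly m z) (poly w z) \<le> 1"
    and \<epsilon>: "0 < \<epsilon>" "\<epsilon> \<le> 1" and R: "0 < R" "R < 1" and \<eta>: "0 < \<eta>"
  obtains u1 m1 w1 r s where
    "pderiv w1 = m1 * pderiv u1"
    "\<And>z. norm z = 1 \<Longrightarrow> \<bar>potential (poly u1 z) (poly m1 z) (poly w1 z)
        - potential (poly u z) (poly m z) (poly w z)\<bar> \<le> 36 * \<epsilon>\<^sup>2"
    "\<And>z. norm z \<le> R \<Longrightarrow> norm (poly (u1 - u) z) \<le> \<eta>"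
    "\<And>z. norm z \<le> R \<Longrightarrow> norm (poly (m1 - m) z) \<le> \<eta>"
    "\<And>z. norm z \<le> R \<Longrightarrow> norm (poly (w1 - w) z) \<le> \<eta>"
    "\<And>z. norm z \<le> R \<Longrightarrow> norm (poly (pderiv (u1 - u)) z) \<le> \<eta>"
    "\<And>z. norm z \<le> R \<Longrightarrow> norm (poly (pderiv (m1 - m)) z) \<le> \<eta>"
    "R < r" "r < s" "s < 1"
    "\<And>z. r \<le> norm z \<Longrightarrow> norm z \<le> s \<Longrightarrow>
        \<epsilon> / 256 \<le> (norm (poly (pderiv u1) z) + norm (poly (pderiv m1) z)) * (s - r)"
    "\<And>z. r \<le> norm z \<Longrightarrow> norm z \<le> s \<Longrightarrow>
        8 \<le> norm (poly (pderiv u1) z) + norm (poly (pderiv m1) z)"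
proof -
  obtain a k b where
    a: "\<And>z. norm z = 1 \<Longrightarrow> poly a z =
        z ^ k * (of_real (Re (poly u z)) + poly m z * of_real (Re (poly w z)))" and
    b: "\<And>z. norm z = 1 \<Longrightarrow> poly b z = z ^ k * cnj (poly m z - \<i>)"
    by (rule circle_direction_polys[of u m w]) blast
  obtain C where C: "0 \<le> C"
    "\<And>M \<epsilon>. (0::real) < \<epsilon> \<Longrightarrow> \<epsilon> \<le> (1::real) \<Longrightarrow> \<exists>w1 E.
        pderiv w1 = (m + smult \<epsilon> (monom 1 M * a)) * pderiv (u - smult \<epsilon> (monom 1 M * b)) \<and>
        (\<forall>z. poly w1 z = poly w z - \<epsilon> * (z ^ M * poly m z * poly b z)
               - (complex_of_real \<epsilon>)\<^sup>2 / 2 * ((z ^ M)\<^sup>2 * poly a z * poly b z) + E z) \<and>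
        (\<forall>z. norm z \<le> 1 \<longrightarrow> norm (E z) \<le> C / (real M + 1))"
    by (rule perturbed_primitive[OF w, of a b]) blast
  have dir: "1 / 8 \<le> norm (poly a z) + norm (poly b z)" if "norm z = 1" for z
    using direction_lower_bound[OF pot(1)[OF that]] that
    by (simp add: a[OF that] b[OF that] norm_mult norm_power)
  have cont: "continuous_on (cball 0 1) (\<lambda>z. norm (poly a z) + norm (poly b z))"
    by (intro continuous_intros)
  \<comment> \<open>The lower bound 1/8 on the circle is halved to obtain an annulus on which it
    persists.\<close>
  obtain r0 where r0: "r0 < 1"
    "\<And>z. r0 \<le> norm z \<Longrightarrow> norm z \<le> 1 \<Longrightarrow> 1 / 16 \<le> norm (poly a z) + norm (poly b z)"
  proof (rule lower_bound_near_circle[OF cont _ dir, of "1 / 16"])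
    show "1 / 16 < (1 / 8 :: real)" by simp
  qed blast+
  obtain Ca where Ca: "0 \<le> Ca" "\<And>z. norm z \<le> 1 \<Longrightarrow> norm (poly a z) \<le> Ca"
    by (rule poly_bounded_on_disk[of a]) blast
  obtain Cb where Cb: "0 \<le> Cb" "\<And>z. norm z \<le> 1 \<Longrightarrow> norm (poly b z) \<le> Cb"
    by (rule poly_bounded_on_disk[of b]) blast
  obtain Cm where Cm: "0 \<le> Cm" "\<And>z. norm z \<le> 1 \<Longrightarrow> norm (poly m z) \<le> Cm"
    by (rule poly_bounded_on_disk[of m]) blast
  obtain Ca' where Ca': "0 \<le> Ca'" "\<And>z. norm z \<le> 1 \<Longrightarrow> norm (poly (pderiv a) z) \<le> Ca'"
    by (rule poly_bounded_on_disk[of "pderiv a"]) blast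
  obtain Cb' where Cb': "0 \<le> Cb'" "\<And>z. norm z \<le> 1 \<Longrightarrow> norm (poly (pderiv b) z) \<le> Cb'"
    by (rule poly_bounded_on_disk[of "pderiv b"]) blast
  obtain Cm' where Cm': "0 \<le> Cm'" "\<And>z. norm z \<le> 1 \<Longrightarrow> norm (poly (pderiv m) z) \<le> Cm'"
    by (rule poly_bounded_on_disk[of "pderiv m"]) blast
  obtain Cu' where Cu': "0 \<le> Cu'" "\<And>z. norm z \<le> 1 \<Longrightarrow> norm (poly (pderiv u) z) \<le> Cu'"
    by (rule poly_bounded_on_disk[of "pderiv u"]) blast
  define D where "D = Ca + Cb + Ca' + Cb' + Cm * Cb + Ca * Cb"
  define C0 where "C0 = Ca' + Cb' + Cm' + Cu'"
  have D: "Ca \<le> D" "Cb \<le> D" "Ca' \<le> D" "Cb' \<le> D" "Cm * Cb + Ca * Cb \<le> D" "0 \<le> D"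
    using Ca(1) Cb(1) Ca'(1) Cb'(1) Cm(1) by (auto simp: D_def)

  have lim1: "(\<lambda>M. C / (real M + 1)) \<longlonglongrightarrow> 0"
    by real_asymp
  have lim2: "(\<lambda>M. (real M * R ^ M / R + R ^ M) * D + C / (real M + 1)) \<longlonglongrightarrow> (0 / R + 0) * D + 0"
    using R by (intro tendsto_intros lim1 powser_times_n_limit_0 LIMSEQ_realpow_zero) auto
  have lim3: "(\<lambda>M. 1 - 1 / (2 * real M)) \<longlonglongrightarrow> 1"
    by real_asymp
  have lim4: "filterlim (\<lambda>M. \<epsilon> * real M) at_top sequentially"
    using \<epsilon>(1) by real_asymp
  have "\<forall>\<^sub>F M in sequentially. C / (real M + 1) < \<epsilon>\<^sup>2"
    using order_tendstoD(2)[OF lim1, of "\<epsilon>\<^sup>2"] \<epsilon> by simp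
  moreover have "\<forall>\<^sub>F M in sequentially. (real M * R ^ M / R + R ^ M) * D + C / (real M + 1) < \<eta>"
    using order_tendstoD(2)[OF lim2, of \<eta>] \<eta> by simp
  moreover have "\<forall>\<^sub>F M in sequentially. max R r0 < 1 - 1 / (2 * real M)"
    using order_tendstoD(1)[OF lim3, of "max R r0"] R r0(1) by simp
  \<comment> \<open>The leading part of the derivatives will be at least
    \<open>\<epsilon> M / 32\<close> and the rest at most \<open>C0\<close>. The term
    \<open>64 * C0\<close> leaves at least \<open>\<epsilon> M / 64\<close>, and 512 makes this at
    least 8.\<close>
  moreover have "\<forall>\<^sub>F M in sequentially. 64 * C0 + 512 \<le> \<epsilon> * real M"
    using lim4 by (simp add: filterlim_at_top)
  moreover have "\<forall>\<^sub>F M in sequentially. 1 \<le> M"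
    by (rule eventually_ge_at_top)
  ultimately have "\<forall>\<^sub>F M in sequentially. C / (real M + 1) < \<epsilon>\<^sup>2 \<and>
      (real M * R ^ M / R + R ^ M) * D + C / (real M + 1) < \<eta> \<and> max R r0 < 1 - 1 / (2 * real M) \<and>
      64 * C0 + 512 \<le> \<epsilon> * real M \<and> 1 \<le> M"
    by eventually_elim blast
  then obtain M where M: "C / (real M + 1) < \<epsilon>\<^sup>2"
    "(real M * R ^ M / R + R ^ M) * D + C / (real M + 1) < \<eta>"
    "max R r0 < 1 - 1 / (2 * real M)" "64 * C0 + 512 \<le> \<epsilon> * real M" "1 \<le> M"
    using eventually_happens[of _ sequentially] by auto

  obtain w1 E where
    w1: "pderiv w1 = (m + smult \<epsilon> (monom 1 M * a)) * pderiv (u - smult \<epsilon> (monom 1 M * b))" and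
    w1_eq: "\<And>z. poly w1 z = poly w z - \<epsilon> * (z ^ M * poly m z * poly b z)
               - (complex_of_real \<epsilon>)\<^sup>2 / 2 * ((z ^ M)\<^sup>2 * poly a z * poly b z) + E z" and
    E: "\<And>z. norm z \<le> 1 \<Longrightarrow> norm (E z) \<le> C / (real M + 1)"
    using C(2)[OF \<epsilon>, of M] by blast
  define u1 where "u1 = u - smult \<epsilon> (monom 1 M * b)"
  define m1 where "m1 = m + smult \<epsilon> (monom 1 M * a)"
  \<comment> \<open>The radii lie so close to 1 that \<open>z ^ M\<close> is still at least 1/2 in
    modulus, and the gap \<open>s - r\<close> is \<open>1 / (4 M)\<close>; times
    \<open>\<epsilon> M / 64\<close> this gives \<open>\<epsilon> / 256\<close>.\<close>
  define r where "r = 1 - 1 / (2 * real M)"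
  define s where "s = 1 - 1 / (4 * real M)"
  have pw: "norm (z ^ M) \<le> R ^ M" if "norm z \<le> R" for z :: complex
    using that by (simp add: norm_power power_mono)
  have small: "R ^ M * D \<le> \<eta>" "R ^ M * D + C / (real M + 1) \<le> \<eta>" "(real M * R ^ M / R + R ^ M) * D \<le> \<eta>"
  proof -
    have "0 \<le> real M * R ^ M / R * D" "0 \<le> C / (real M + 1)" using R C(1) D(6) by auto
    then show "R ^ M * D \<le> \<eta>" "R ^ M * D + C / (real M + 1) \<le> \<eta>" "(real M * R ^ M / R + R ^ M) * D \<le> \<eta>"
      using M(2) by (simp_all add: distrib_right)
  qed
  have dpert: "norm (poly (pderiv (smult \<epsilon> (monom 1 M * p))) z) \<le> \<eta>"
    if "norm z \<le> R" "norm (poly p z) \<le> D" "norm (poly (pderiv p) z) \<le> D" for p :: "complex poly" and z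
  proof -
    have "norm (poly (pderiv (smult \<epsilon> (monom 1 M * p))) z)
        \<le> \<epsilon> * (real M * norm z ^ (M - 1) * norm (poly p z) + norm z ^ M * norm (poly (pderiv p) z))"
      unfolding pderiv_smult poly_smult poly_pderiv_monom_mult norm_mult
      using \<epsilon> by (intro mult_mono order_trans[OF norm_triangle_ineq]) (auto simp: norm_mult norm_power)
    also have "\<dots> \<le> 1 * (real M * R ^ (M - 1) * D + R ^ M * D)"
      using \<epsilon> that R D(6) by (intro mult_mono add_mono power_mono) auto
    also have "R ^ (M - 1) = R ^ M / R" using M(5) R by (simp add: power_diff)
    finally show ?thesis using small(3) by (simp add: distrib_right)
  qed
  have pert: "norm (poly (smult \<epsilon> (monom 1 M * p)) z) \<le> \<eta>"
    if "norm z \<le> R" "norm (poly p z) \<le> D" for p :: "complex poly" and z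
  proof -
    have "norm (poly (smult \<epsilon> (monom 1 M * p)) z) = \<epsilon> * (norm (z ^ M) * norm (poly p z))"
      using \<epsilon> by (simp add: poly_monom norm_mult)
    also have "\<dots> \<le> 1 * (R ^ M * D)"
      using \<epsilon> pw[OF that(1)] that(2) R by (intro mult_mono) auto
    finally show ?thesis using small(1) by simp
  qed
  have ann: "\<epsilon> * real M / 64 \<le> norm (poly (pderiv u1) z) + norm (poly (pderiv m1) z)"
    if z: "r \<le> norm z" "norm z \<le> s" for z
  proof -
    have "0 \<le> 1 / (4 * real M)" by simp
    then have z1: "norm z \<le> 1" using z(2) unfolding s_def by linarith
    have r_pos: "0 \<le> r" using M(3) R by (simp add: r_def)
    have "1 / 2 \<le> 1 + real M * (- (1 / (2 * real M)))" using M(5) by simp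
    also have "\<dots> \<le> (1 + - (1 / (2 * real M))) ^ M"
      using M(5) by (intro Bernoulli_inequality) (simp add: field_simps)
    also have "\<dots> = r ^ M" by (simp add: r_def)
    also have "\<dots> \<le> norm z ^ M" using z(1) r_pos by (rule power_mono)
    also have "\<dots> \<le> norm z ^ (M - 1)" using z1 by (intro power_decreasing) auto
    finally have half: "1 / 2 \<le> norm z ^ (M - 1)" .
    \<comment> \<open>In the product rule the term that differentiates \<open>z ^ M\<close>
      dominates; everything else is bounded independently of \<open>M\<close> and is collected in
      \<open>K\<close>.\<close>
    have main: "\<epsilon> * real M * norm z ^ (M - 1) * norm (poly p z) - K
        \<le> norm (poly (pderiv q + pderiv (smult c (monom 1 M * p))) z)"
      if "norm c = \<epsilon>" "norm (poly (pderiv q) z) + norm (poly (pderiv p) z) \<le> K" for p q c K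
    proof -
      let ?X = "c * (of_nat M * z ^ (M - 1) * poly p z)"
        and ?Y = "poly (pderiv q) z + c * (z ^ M * poly (pderiv p) z)"
      have "norm ?Y \<le> norm (poly (pderiv q) z) + \<epsilon> * (norm z ^ M * norm (poly (pderiv p) z))"
        by (rule order_trans[OF norm_triangle_ineq]) (simp add: norm_mult norm_power that(1))
      also have "\<dots> \<le> norm (poly (pderiv q) z) + 1 * (1 * norm (poly (pderiv p) z))"
        using \<epsilon> z1 by (intro add_mono mult_mono power_le_one) auto
      finally have "norm ?Y \<le> K" using that(2) by simp
      moreover have "norm ?X = \<epsilon> * real M * norm z ^ (M - 1) * norm (poly p z)"
        by (simp add: norm_mult norm_power that(1))
      moreover have eq: "?X + ?Y = poly (pderiv q + pderiv (smult c (monom 1 M * p))) z"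
        by (simp add: pderiv_smult poly_pderiv_monom_mult distrib_left)
      have "norm ?X - norm ?Y \<le> norm (poly (pderiv q + pderiv (smult c (monom 1 M * p))) z)"
        unfolding eq[symmetric] by (rule norm_diff_ineq)
      ultimately show ?thesis by linarith
    qed
    have "pderiv u1 = pderiv u + pderiv (smult (- complex_of_real \<epsilon>) (monom 1 M * b))"
      by (simp add: u1_def pderiv_diff pderiv_smult pderiv_minus)
    then have "\<epsilon> * real M * norm z ^ (M - 1) * norm (poly b z) - (Cu' + Cb') \<le> norm (poly (pderiv u1) z)"
      using main[of "- complex_of_real \<epsilon>" u b "Cu' + Cb'"] \<epsilon> Cu'(2)[OF z1] Cb'(2)[OF z1] by simp
    moreover have "pderiv m1 = pderiv m + pderiv (smult \<epsilon> (monom 1 M * a))"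
      by (simp add: m1_def pderiv_add)
    then have "\<epsilon> * real M * norm z ^ (M - 1) * norm (poly a z) - (Cm' + Ca') \<le> norm (poly (pderiv m1) z)"
      using main[of "complex_of_real \<epsilon>" m a "Cm' + Ca'"] \<epsilon> Cm'(2)[OF z1] Ca'(2)[OF z1] by simp
    moreover have "\<epsilon> * real M * (1 / 2) * (1 / 16)
        \<le> \<epsilon> * real M * norm z ^ (M - 1) * (norm (poly a z) + norm (poly b z))"
      using half r0(2)[of z] z1 z(1) M(3) \<epsilon> by (intro mult_mono) (auto simp: r_def)
    ultimately show ?thesis using M(4) unfolding C0_def by (simp add: distrib_left)
  qed
  show thesis
  proof (rule that[of w1 m1 u1 r s])
    show "pderiv w1 = m1 * pderiv u1" using w1 by (simp add: m1_def u1_def)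
    show "\<bar>potential (poly u1 z) (poly m1 z) (poly w1 z)
        - potential (poly u z) (poly m z) (poly w z)\<bar> \<le> 36 * \<epsilon>\<^sup>2" if z: "norm z = 1" for z
    proof -
      \<comment> \<open>On the circle \<open>a\<close> and \<open>b\<close> already carry the factor
        \<open>z ^ k\<close>, so the unimodular \<open>t\<close> of \<open>potential_change\<close>
        is \<open>z ^ (M + k)\<close>; the choice of \<open>M\<close> makes \<open>E z\<close>
        smaller than \<open>\<epsilon>\<^sup>2\<close>.\<close>
      have "norm (z ^ (M + k)) = 1" using z by (simp add: norm_power)
      from potential_change[OF this \<epsilon> _ pot(2)[OF z], of "E z"] E[of z] M(1) z
      show ?thesis
        by (simp add: u1_def m1_def w1_eq a[OF z] b[OF z] poly_monom power_add power2_eq_square mult_ac)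
    qed
    fix z :: complex assume z: "norm z \<le> R"
    then have z1: "norm z \<le> 1" using R by simp
    note bds = Ca(2)[OF z1] Cb(2)[OF z1] Cm(2)[OF z1] Ca'(2)[OF z1] Cb'(2)[OF z1]
    show "norm (poly (u1 - u) z) \<le> \<eta>"
      using pert[OF z, of b] bds D by (simp add: u1_def norm_minus_commute)
    show "norm (poly (m1 - m) z) \<le> \<eta>"
      using pert[OF z, of a] bds D by (simp add: m1_def)
    show "norm (poly (pderiv (u1 - u)) z) \<le> \<eta>"
      using dpert[OF z, of b] bds D by (simp add: u1_def pderiv_minus)
    show "norm (poly (pderiv (m1 - m)) z) \<le> \<eta>"
      using dpert[OF z, of a] bds D by (simp add: m1_def)
    show "norm (poly (w1 - w) z) \<le> \<eta>"
    proof -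
      have "poly (w1 - w) z = E z + (- \<epsilon> * (z ^ M * poly m z * poly b z)
               - (complex_of_real \<epsilon>)\<^sup>2 / 2 * ((z ^ M)\<^sup>2 * poly a z * poly b z))"
        by (simp add: w1_eq)
      also have "norm \<dots> \<le> norm (E z) + (norm (- \<epsilon> * (z ^ M * poly m z * poly b z))
          + norm ((complex_of_real \<epsilon>)\<^sup>2 / 2 * ((z ^ M)\<^sup>2 * poly a z * poly b z)))"
        by (intro order_trans[OF norm_triangle_ineq] add_left_mono norm_triangle_ineq4)
      also have "norm (- \<epsilon> * (z ^ M * poly m z * poly b z)) \<le> 1 * (R ^ M * Cm * Cb)"
        unfolding norm_mult using \<epsilon> pw[OF z] bds Cm(1) Cb(1) R by (intro mult_mono) auto
      also have "norm ((complex_of_real \<epsilon>)\<^sup>2 / 2 * ((z ^ M)\<^sup>2 * poly a z * poly b z)) \<le> 1 * (R ^ M * Ca * Cb)"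
      proof -
        have "norm (z ^ M) * norm (z ^ M) \<le> R ^ M * 1"
          using pw[OF z] z1 R by (intro mult_mono) (auto simp: norm_power power_le_one)
        then have "norm ((z ^ M)\<^sup>2) \<le> R ^ M" by (simp add: power2_eq_square norm_mult)
        moreover have "norm ((complex_of_real \<epsilon>)\<^sup>2 / 2) \<le> 1"
          using \<epsilon> power_le_one[of \<epsilon> 2] by (simp add: norm_divide norm_power)
        ultimately show ?thesis
          unfolding norm_mult using bds Ca(1) Cb(1) R by (intro mult_mono) auto
      qed
      finally have "norm (poly (w1 - w) z) \<le> R ^ M * (Cm * Cb + Ca * Cb) + C / (real M + 1)"
        using E[OF z1] by (simp add: algebra_simps)
      also have "\<dots> \<le> R ^ M * D + C / (real M + 1)"
        using D R by (intro add_mono mult_left_mono) auto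
      finally show ?thesis using small(2) by simp
    qed
  next
    fix z :: complex assume z: "r \<le> norm z" "norm z \<le> s"
    have sr: "s - r = 1 / (4 * real M)" using M(5) by (simp add: r_def s_def field_simps)
    then have "\<epsilon> * real M / 64 * (s - r) = \<epsilon> / 256" using M(5) by simp
    moreover have "0 \<le> s - r" unfolding sr by simp
    ultimately show "\<epsilon> / 256 \<le> (norm (poly (pderiv u1) z) + norm (poly (pderiv m1) z)) * (s - r)"
      using mult_right_mono[OF ann[OF z], of "s - r"] by linarith
    have "0 \<le> C0" using Ca'(1) Cb'(1) Cm'(1) Cu'(1) by (simp add: C0_def)
    then show "8 \<le> norm (poly (pderiv u1) z) + norm (poly (pderiv m1) z)"
      using ann[OF z] M(4) by simp
  qed (use M(3,5) in \<open>auto simp: r_def s_def field_simps\<close>)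
qed

section \<open>The limit curve\<close>

text \<open>The geometric tail is summed from \<open>n\<close> on. Steps are controlled only for
  \<open>k\<close> at least \<open>n\<close>, because at a given point the estimates hold only once
  the disk of radius \<open>R k\<close> contains it.\<close>

lemma limit_close_to_term:
  fixes a :: "nat \<Rightarrow> 'a::real_normed_vector"
  assumes step: "\<And>k. n \<le> k \<Longrightarrow> norm (a (Suc k) - a k) \<le> c / 2 ^ k" and lim: "a \<longlonglongrightarrow> l"
  shows "norm (l - a n) \<le> 2 * c / 2 ^ n"
proof -
  have "norm (a (n + j) - a n) \<le> 2 * c / 2 ^ n - 2 * c / 2 ^ (n + j)" for j
  proof (induction j)
    case (Suc j)
    have "norm (a (n + Suc j) - a n) \<le> norm (a (Suc (n + j)) - a (n + j)) + norm (a (n + j) - a n)"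
      using norm_triangle_ineq[of "a (Suc (n + j)) - a (n + j)" "a (n + j) - a n"] by simp
    also have "\<dots> \<le> c / 2 ^ (n + j) + (2 * c / 2 ^ n - 2 * c / 2 ^ (n + j))"
      using Suc step[of "n + j"] by (intro add_mono) auto
    also have "\<dots> = 2 * c / 2 ^ n - 2 * c / 2 ^ (n + Suc j)"
      by simp
    finally show ?case .
  qed simp
  moreover have "0 \<le> c / 2 ^ n" using order_trans[OF norm_ge_zero step[of n]] by simp
  then have "0 \<le> c" by (smt (verit) divide_neg_pos zero_less_power)
  ultimately have "norm (a (n + j) - a n) \<le> 2 * c / 2 ^ n" for j
    by (smt (verit) divide_nonneg_pos zero_less_power)
  moreover have "(\<lambda>j. norm (a (j + n) - a n)) \<longlonglongrightarrow> norm (l - a n)"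
    by (intro tendsto_intros LIMSEQ_ignore_initial_segment lim)
  ultimately show ?thesis
    by (intro Lim_bounded[where M = 0]) (auto simp: add.commute)
qed

text \<open>The disks of radius \<open>R N\<close> exhaust the unit disk. On each of them the step
  bounds hold from index \<open>N\<close> on, so the Weierstrass test applies eventually; locally
  uniform convergence then carries over to the derivatives.\<close>

lemma poly_sequence_limit:
  fixes p :: "nat \<Rightarrow> complex poly" and R :: "nat \<Rightarrow> real"
  assumes R: "\<And>n. 1 - 1 / (real n + 1) \<le> R n" "\<And>n. R n < 1" "incseq R"
    and step: "\<And>n z. norm z \<le> R n \<Longrightarrow> norm (poly (p (Suc n) - p n) z) \<le> c / 2 ^ n"
  obtains f where "f holomorphic_on ball 0 1"
    "\<And>z. z \<in> ball 0 1 \<Longrightarrow> (\<lambda>n. poly (p n) z) \<longlonglongrightarrow> f z"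
    "\<And>z. z \<in> ball 0 1 \<Longrightarrow> (\<lambda>n. poly (pderiv (p n)) z) \<longlonglongrightarrow> deriv f z"
proof -
  define f where "f z = poly (p 0) z + (\<Sum>i. poly (p (Suc i) - p i) z)" for z
  have ul: "uniform_limit (cball 0 (R N)) (\<lambda>n z. poly (p n) z) f sequentially" for N
  proof -
    have "uniform_limit (cball 0 (R N)) (\<lambda>n z. \<Sum>i<n. poly (p (Suc i) - p i) z)
        (\<lambda>z. \<Sum>i. poly (p (Suc i) - p i) z) sequentially"
    proof (rule Weierstrass_m_test_ev)
      show "\<forall>\<^sub>F i in sequentially. \<forall>z\<in>cball 0 (R N). norm (poly (p (Suc i) - p i) z) \<le> c * (1 / 2) ^ i"
        using eventually_ge_at_top[of N]
      proof eventually_elim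
        case (elim i)
        show ?case using step[of _ i] incseqD[OF R(3) elim] by (force simp: power_one_over)
      qed
      show "summable (\<lambda>i. c * (1 / 2) ^ i)" by (intro summable_mult summable_geometric) simp
    qed
    then have "uniform_limit (cball 0 (R N))
        (\<lambda>n z. poly (p 0) z + (\<Sum>i<n. poly (p (Suc i) - p i) z))
        (\<lambda>z. poly (p 0) z + (\<Sum>i. poly (p (Suc i) - p i) z)) sequentially"
      by (intro uniform_limit_intros)
    moreover have "poly (p 0) z + (\<Sum>i<n. poly (p (Suc i) - p i) z) = poly (p n) z" for n z
      using sum_lessThan_telescope[of "\<lambda>i. poly (p i) z" n] by simp
    ultimately show ?thesis by (simp add: f_def[abs_def])
  qed
  have loc: "\<exists>d>0. cball x d \<subseteq> ball 0 1 \<and> uniform_limit (cball x d) (\<lambda>n z. poly (p n) z) f sequentially"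
    if "x \<in> ball 0 1" for x
  proof -
    have "(\<lambda>n. 1 - 1 / (real n + 1)) \<longlonglongrightarrow> 1" by real_asymp
    then have "\<forall>\<^sub>F n in sequentially. norm x < 1 - 1 / (real n + 1)"
      using that by (intro order_tendstoD(1)) auto
    then obtain N where N: "norm x < R N"
      using eventually_happens'[OF sequentially_bot] R(1) by (meson less_le_trans)
    have "cball x (R N - norm x) \<subseteq> cball 0 (R N)"
      by (simp add: cball_subset_cball_iff)
    moreover have "cball 0 (R N) \<subseteq> ball (0 :: complex) 1" using R(2)[of N] by auto
    ultimately show ?thesis
      using N ul[of N] by (intro exI[of _ "R N - norm x"]) (auto intro: uniform_limit_on_subset)
  qed
  obtain f' where f': "\<And>z. z \<in> ball 0 1 \<Longrightarrow> (f has_field_derivative f' z) (at z)"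
    "\<And>z. z \<in> ball 0 1 \<Longrightarrow> (\<lambda>n. poly (pderiv (p n)) z) \<longlonglongrightarrow> f' z"
    using has_complex_derivative_uniform_sequence[OF open_ball poly_DERIV loc] by blast
  show thesis
  proof (rule that)
    show "f holomorphic_on ball 0 1"
      using f'(1) unfolding holomorphic_on_open[OF open_ball] by blast
    fix z :: complex assume z: "z \<in> ball 0 1"
    then obtain d where "d > 0" "uniform_limit (cball z d) (\<lambda>n z. poly (p n) z) f sequentially"
      using loc by blast
    then show "(\<lambda>n. poly (p n) z) \<longlonglongrightarrow> f z"
      by (intro tendsto_uniform_limitI) auto
    show "(\<lambda>n. poly (pderiv (p n)) z) \<longlonglongrightarrow> deriv f z"
      using f'[OF z] by (simp add: DERIV_imp_deriv)
  qed
qed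

text \<open>The potential is controlled on the circle only. The maximum principle, for the real
  parts of \<open>u\<close>, \<open>-u\<close>, \<open>w\<close>, \<open>-w\<close> and for the
  modulus of \<open>m - \<i>\<close>, brings the separate bounds inside.\<close>

lemma potential_disk_bounds:
  fixes u m w :: "complex poly"
  assumes pot: "\<And>z. norm z = 1 \<Longrightarrow> potential (poly u z) (poly m z) (poly w z) \<le> 1"
    and z: "z \<in> ball 0 1"
  shows "\<bar>Re (poly u z)\<bar> \<le> 1" "\<bar>Re (poly w z)\<bar> \<le> 1" "norm (poly m z - \<i>) \<le> 1"
proof -
  have re: "Re (poly p z) \<le> 1" if "\<And>z. norm z = 1 \<Longrightarrow> Re (poly p z) \<le> 1" for p
    by (rule maximum_real_frontier[of "poly p" "ball 0 1"])
       (use that z in \<open>auto intro!: holomorphic_intros continuous_intros\<close>)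
  note bd = potential_bounds[OF pot]
  have "Re (poly u z) \<le> 1" "Re (poly (- u) z) \<le> 1" "Re (poly w z) \<le> 1" "Re (poly (- w) z) \<le> 1"
    by (intro re, use bd in \<open>force simp: abs_le_iff\<close>)+
  then show "\<bar>Re (poly u z)\<bar> \<le> 1" "\<bar>Re (poly w z)\<bar> \<le> 1" by (auto simp: abs_le_iff)
  show "norm (poly m z - \<i>) \<le> 1"
    by (rule maximum_modulus_frontier[of "\<lambda>z. poly m z - \<i>" "ball 0 1"])
       (use bd z in \<open>auto intro!: holomorphic_intros continuous_intros\<close>)
qed

section \<open>The recursion and its limit\<close>

lemma perturbation_sequence:
  obtains u m w :: "nat \<Rightarrow> complex poly" and R r s :: "nat \<Rightarrow> real"
  where "\<And>n. pderiv (w n) = m n * pderiv (u n)"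
    "\<And>n z. norm z = 1 \<Longrightarrow> potential (poly (u n) z) (poly (m n) z) (poly (w n) z) \<le> 1"
    "m 0 = [:\<i>, 1 / 2:]"
    "\<And>n. 0 < R n" "\<And>n. R n < 1" "\<And>n. 1 - 1 / (real n + 1) \<le> R n"
    "\<And>n z. norm z \<le> R n \<Longrightarrow> norm (poly (u (Suc n) - u n) z) \<le> (1 / 8) / 2 ^ n"
    "\<And>n z. norm z \<le> R n \<Longrightarrow> norm (poly (m (Suc n) - m n) z) \<le> (1 / 8) / 2 ^ n"
    "\<And>n z. norm z \<le> R n \<Longrightarrow> norm (poly (w (Suc n) - w n) z) \<le> (1 / 8) / 2 ^ n"
    "\<And>n z. norm z \<le> R n \<Longrightarrow> norm (poly (pderiv (u (Suc n) - u n)) z) \<le> (1 / 8) / 2 ^ n"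
    "\<And>n z. norm z \<le> R n \<Longrightarrow> norm (poly (pderiv (m (Suc n) - m n)) z) \<le> (1 / 8) / 2 ^ n"
    "\<And>n. R n < r n" "\<And>n. r n < s n" "\<And>n. s n \<le> R (Suc n)"
    "\<And>n z. r n \<le> norm z \<Longrightarrow> norm z \<le> s n \<Longrightarrow> 1 / (20 * (real n + 1)) / 256 \<le>
       (norm (poly (pderiv (u (Suc n))) z) + norm (poly (pderiv (m (Suc n))) z)) * (s n - r n)"
    "\<And>n z. r n \<le> norm z \<Longrightarrow> norm z \<le> s n \<Longrightarrow>
       8 \<le> norm (poly (pderiv (u (Suc n))) z) + norm (poly (pderiv (m (Suc n))) z)"
proof -
  \<comment> \<open>The potential may drift from 1/2 by less than 1/4 in total, and
    \<open>1 / (4 * (real n + 1))\<close> is the part of this budget still left. The condition on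
    \<open>m\<close> at \<open>n = 0\<close> is kept to exclude a constant limit of
    \<open>m\<close>.\<close>
  define P where "P = (\<lambda>n (u, m, w, R). pderiv w = m * pderiv u \<and>
      (\<forall>z. norm z = 1 \<longrightarrow> \<bar>potential (poly u z) (poly m z) (poly w z) - 1 / 2\<bar>
          \<le> 1 / 4 - 1 / (4 * (real n + 1))) \<and>
      0 < R \<and> R < 1 \<and> 1 - 1 / (real n + 1) \<le> R \<and> (n = 0 \<longrightarrow> m = [:\<i>, 1 / 2:]))"
  define Q where "Q = (\<lambda>n (u :: complex poly, m :: complex poly, w :: complex poly, R :: real)
        (u1 :: complex poly, m1 :: complex poly, w1 :: complex poly, R1 :: real).
      (\<forall>z. norm z \<le> R \<longrightarrow> norm (poly (u1 - u) z) \<le> (1 / 8) / 2 ^ n \<and>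
         norm (poly (m1 - m) z) \<le> (1 / 8) / 2 ^ n \<and> norm (poly (w1 - w) z) \<le> (1 / 8) / 2 ^ n \<and>
         norm (poly (pderiv (u1 - u)) z) \<le> (1 / 8) / 2 ^ n \<and>
         norm (poly (pderiv (m1 - m)) z) \<le> (1 / 8) / 2 ^ n) \<and>
      (\<exists>r s. R < r \<and> r < s \<and> s \<le> R1 \<and>
         (\<forall>z. r \<le> norm z \<longrightarrow> norm z \<le> s \<longrightarrow> 1 / (20 * (real n + 1)) / 256 \<le>
            (norm (poly (pderiv u1) z) + norm (poly (pderiv m1) z)) * (s - r) \<and>
            8 \<le> norm (poly (pderiv u1) z) + norm (poly (pderiv m1) z))))"
  have "\<exists>f. \<forall>n. P n (f n) \<and> Q n (f n) (f (Suc n))"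
  proof (rule dependent_nat_choice)
    \<comment> \<open>The whole budget is intact at the start: on the circle the potential equals
      1/4 + 0 + 1/4, exactly 1/2.\<close>
    have "P 0 ([:1 / 2:], [:\<i>, 1 / 2:], 0, 1 / 2)"
      by (auto simp: P_def potential_def norm_mult power2_eq_square)
    then show "\<exists>x. P 0 x" ..
  next
    fix x n assume Px: "P n x"
    obtain u m w R where x: "x = (u, m, w, R)" by (metis prod_cases4)
    have w: "pderiv w = m * pderiv u" and R: "0 < R" "R < 1"
      and pot: "\<And>z. norm z = 1 \<Longrightarrow> \<bar>potential (poly u z) (poly m z) (poly w z) - 1 / 2\<bar>
          \<le> 1 / 4 - 1 / (4 * (real n + 1))"
      using Px unfolding P_def x by auto
    have n0: "0 < 1 / (4 * (real n + 1))" by simp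
    define \<epsilon> where "\<epsilon> = 1 / (20 * (real n + 1))"
    have \<epsilon>: "0 < \<epsilon>" "\<epsilon> \<le> 1" by (auto simp: \<epsilon>_def field_simps)
    have pot_l: "1 / 4 \<le> potential (poly u z) (poly m z) (poly w z)"
      and pot_u: "potential (poly u z) (poly m z) (poly w z) \<le> 1" if "norm z = 1" for z
      using pot[OF that] n0 by linarith+
    have \<eta>: "0 < (1 / 8 :: real) / 2 ^ n" by simp
    obtain w1 m1 u1 r s where
      1: "pderiv w1 = m1 * pderiv u1" and
      2: "\<And>z. norm z = 1 \<Longrightarrow> \<bar>potential (poly u1 z) (poly m1 z) (poly w1 z)
        - potential (poly u z) (poly m z) (poly w z)\<bar> \<le> 36 * \<epsilon>\<^sup>2" and
      3: "\<And>z. norm z \<le> R \<Longrightarrow> norm (poly (u1 - u) z) \<le> (1 / 8) / 2 ^ n"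
      "\<And>z. norm z \<le> R \<Longrightarrow> norm (poly (m1 - m) z) \<le> (1 / 8) / 2 ^ n"
      "\<And>z. norm z \<le> R \<Longrightarrow> norm (poly (w1 - w) z) \<le> (1 / 8) / 2 ^ n"
      "\<And>z. norm z \<le> R \<Longrightarrow> norm (poly (pderiv (u1 - u)) z) \<le> (1 / 8) / 2 ^ n"
      "\<And>z. norm z \<le> R \<Longrightarrow> norm (poly (pderiv (m1 - m)) z) \<le> (1 / 8) / 2 ^ n" and
      4: "R < r" "r < s" "s < 1" and
      5: "\<And>z. r \<le> norm z \<Longrightarrow> norm z \<le> s \<Longrightarrow>
          \<epsilon> / 256 \<le> (norm (poly (pderiv u1) z) + norm (poly (pderiv m1) z)) * (s - r)"
      "\<And>z. r \<le> norm z \<Longrightarrow> norm z \<le> s \<Longrightarrow>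
          8 \<le> norm (poly (pderiv u1) z) + norm (poly (pderiv m1) z)"
      by (rule perturbation_step[OF w pot_l pot_u \<epsilon> R \<eta>]) blast+
    \<comment> \<open>The next protected disk contains the new annulus, and its radius is forced
      towards 1.\<close>
    let ?R1 = "max s (1 - 1 / (real (Suc n) + 1))"
    \<comment> \<open>The left side is \<open>9 / 100\<close> over \<open>(n + 1)^2\<close>; the
      right side is \<open>1 / (4 (n + 1) (n + 2))\<close>, at least \<open>1 / 8\<close> over
      \<open>(n + 1)^2\<close>. This fixes the 20 in \<open>\<epsilon>\<close>.\<close>
    have budget: "36 * \<epsilon>\<^sup>2 \<le> 1 / (4 * (real n + 1)) - 1 / (4 * (real (Suc n) + 1))"
      by (simp add: \<epsilon>_def power2_eq_square divide_simps) (simp add: algebra_simps)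
    have "\<bar>potential (poly u1 z) (poly m1 z) (poly w1 z) - 1 / 2\<bar>
        \<le> 1 / 4 - 1 / (4 * (real (Suc n) + 1))" if "norm z = 1" for z
      using pot[OF that] 2[OF that] budget by linarith
    then have "P (Suc n) (u1, m1, w1, ?R1)"
      using 1 4 R by (auto simp: P_def less_max_iff_disj)
    moreover have "Q n x (u1, m1, w1, ?R1)"
    proof -
      have "\<forall>z. norm z \<le> R \<longrightarrow> norm (poly (u1 - u) z) \<le> (1 / 8) / 2 ^ n \<and>
         norm (poly (m1 - m) z) \<le> (1 / 8) / 2 ^ n \<and> norm (poly (w1 - w) z) \<le> (1 / 8) / 2 ^ n \<and>
         norm (poly (pderiv (u1 - u)) z) \<le> (1 / 8) / 2 ^ n \<and>
         norm (poly (pderiv (m1 - m)) z) \<le> (1 / 8) / 2 ^ n"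
        by (intro allI impI conjI 3)
      moreover have "\<forall>z. r \<le> norm z \<longrightarrow> norm z \<le> s \<longrightarrow> 1 / (20 * (real n + 1)) / 256 \<le>
            (norm (poly (pderiv u1) z) + norm (poly (pderiv m1) z)) * (s - r) \<and>
            8 \<le> norm (poly (pderiv u1) z) + norm (poly (pderiv m1) z)"
        by (intro allI impI conjI 5[unfolded \<epsilon>_def])
      moreover have "s \<le> ?R1" by (rule max.cobounded1)
      ultimately show ?thesis unfolding Q_def x prod.case using 4(1,2) by blast
    qed
    ultimately show "\<exists>y. P (Suc n) y \<and> Q n x y" by blast
  qed
  then obtain f where f: "\<And>n. P n (f n)" "\<And>n. Q n (f n) (f (Suc n))" by blast
  define u m w R where "u n = fst (f n)" and "m n = fst (snd (f n))" and "w n = fst (snd (snd (f n)))"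
    and "R n = snd (snd (snd (f n)))" for n
  have fn: "f n = (u n, m n, w n, R n)" for n by (simp add: u_def m_def w_def R_def)
  note P = f(1)[unfolded fn P_def prod.case] and Q = f(2)[unfolded fn Q_def prod.case]
  define B where "B n r s \<longleftrightarrow> R n < r \<and> r < s \<and> s \<le> R (Suc n) \<and>
         (\<forall>z. r \<le> norm z \<longrightarrow> norm z \<le> s \<longrightarrow> 1 / (20 * (real n + 1)) / 256 \<le>
            (norm (poly (pderiv (u (Suc n))) z) + norm (poly (pderiv (m (Suc n))) z)) * (s - r) \<and>
            8 \<le> norm (poly (pderiv (u (Suc n))) z) + norm (poly (pderiv (m (Suc n))) z))" for n r s
  have "\<forall>n. \<exists>r s. B n r s"
    unfolding B_def using Q by blast
  then obtain r s where "\<And>n. B n (r n) (s n)"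
    by metis
  note rs = this[unfolded B_def]
  have Q1: "norm (poly (u (Suc n) - u n) z) \<le> (1 / 8) / 2 ^ n \<and>
      norm (poly (m (Suc n) - m n) z) \<le> (1 / 8) / 2 ^ n \<and>
      norm (poly (w (Suc n) - w n) z) \<le> (1 / 8) / 2 ^ n \<and>
      norm (poly (pderiv (u (Suc n) - u n)) z) \<le> (1 / 8) / 2 ^ n \<and>
      norm (poly (pderiv (m (Suc n) - m n)) z) \<le> (1 / 8) / 2 ^ n" if "norm z \<le> R n" for n z
    using Q[of n] that by blast
  show thesis
  proof (rule that[of w m u R r s])
    show "pderiv (w n) = m n * pderiv (u n)" "0 < R n" "R n < 1" "1 - 1 / (real n + 1) \<le> R n" for n
      using P[of n] by blast+
    show "m 0 = [:\<i>, 1 / 2:]" using P[of 0] by blast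
    show "potential (poly (u n) z) (poly (m n) z) (poly (w n) z) \<le> 1" if "norm z = 1" for n z
    proof -
      have "\<bar>potential (poly (u n) z) (poly (m n) z) (poly (w n) z) - 1 / 2\<bar>
          \<le> 1 / 4 - 1 / (4 * (real n + 1))"
        using P[of n] that by blast
      moreover have "0 \<le> 1 / (4 * (real n + 1))" by simp
      ultimately show ?thesis by linarith
    qed
    show "R n < r n" "r n < s n" "s n \<le> R (Suc n)" for n
      using rs[of n] by blast+
    fix n z
    show "1 / (20 * (real n + 1)) / 256 \<le>
       (norm (poly (pderiv (u (Suc n))) z) + norm (poly (pderiv (m (Suc n))) z)) * (s n - r n)"
      "8 \<le> norm (poly (pderiv (u (Suc n))) z) + norm (poly (pderiv (m (Suc n))) z)"
      if "r n \<le> norm z" "norm z \<le> s n"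
      using rs[of n] that by blast+
    assume "norm z \<le> R n"
    note Q1 = Q1[OF this]
    show "norm (poly (u (Suc n) - u n) z) \<le> (1 / 8) / 2 ^ n" using Q1 by (elim conjE)
    show "norm (poly (m (Suc n) - m n) z) \<le> (1 / 8) / 2 ^ n" using Q1 by (elim conjE)
    show "norm (poly (w (Suc n) - w n) z) \<le> (1 / 8) / 2 ^ n" using Q1 by (elim conjE)
    show "norm (poly (pderiv (u (Suc n) - u n)) z) \<le> (1 / 8) / 2 ^ n" using Q1 by (elim conjE)
    show "norm (poly (pderiv (m (Suc n) - m n)) z) \<le> (1 / 8) / 2 ^ n" using Q1 by (elim conjE)
  qed
qed

lemma limit_curve:
  obtains u m w :: "complex \<Rightarrow> complex" and r s :: "nat \<Rightarrow> real"
  where "u holomorphic_on ball 0 1" "m holomorphic_on ball 0 1" "w holomorphic_on ball 0 1"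
    "\<And>z. z \<in> ball 0 1 \<Longrightarrow> deriv w z = m z * deriv u z"
    "\<And>z. z \<in> ball 0 1 \<Longrightarrow> \<bar>Re (u z)\<bar> \<le> 1" "\<And>z. z \<in> ball 0 1 \<Longrightarrow> \<bar>Re (w z)\<bar> \<le> 1"
    "\<And>z. z \<in> ball 0 1 \<Longrightarrow> norm (m z - \<i>) \<le> 1"
    "deriv m 0 \<noteq> 0"
    "\<And>n. 0 \<le> r n" "\<And>n. r n < s n" "\<And>n. s n \<le> r (Suc n)" "\<And>n. s n < 1"
    "\<And>n z. r n \<le> norm z \<Longrightarrow> norm z \<le> s n \<Longrightarrow>
       1 / (20 * (real n + 1)) / 512 \<le> (norm (deriv u z) + norm (deriv m z)) * (s n - r n)"
    "\<And>n z. r n \<le> norm z \<Longrightarrow> norm z \<le> s n \<Longrightarrow> 7 \<le> norm (deriv u z) + norm (deriv m z)"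
proof -
  obtain w m u :: "nat \<Rightarrow> complex poly" and R r s :: "nat \<Rightarrow> real" where
    w: "\<And>n. pderiv (w n) = m n * pderiv (u n)" and
    pot: "\<And>n z. norm z = 1 \<Longrightarrow> potential (poly (u n) z) (poly (m n) z) (poly (w n) z) \<le> 1" and
    m0: "m 0 = [:\<i>, 1 / 2:]" and
    R: "\<And>n. 0 < R n" "\<And>n. R n < 1" "\<And>n. 1 - 1 / (real n + 1) \<le> R n" and
    step: "\<And>n z. norm z \<le> R n \<Longrightarrow> norm (poly (u (Suc n) - u n) z) \<le> (1 / 8) / 2 ^ n"
    "\<And>n z. norm z \<le> R n \<Longrightarrow> norm (poly (m (Suc n) - m n) z) \<le> (1 / 8) / 2 ^ n"
    "\<And>n z. norm z \<le> R n \<Longrightarrow> norm (poly (w (Suc n) - w n) z) \<le> (1 / 8) / 2 ^ n" and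
    step': "\<And>n z. norm z \<le> R n \<Longrightarrow> norm (poly (pderiv (u (Suc n) - u n)) z) \<le> (1 / 8) / 2 ^ n"
    "\<And>n z. norm z \<le> R n \<Longrightarrow> norm (poly (pderiv (m (Suc n) - m n)) z) \<le> (1 / 8) / 2 ^ n" and
    rs: "\<And>n. R n < r n" "\<And>n. r n < s n" "\<And>n. s n \<le> R (Suc n)" and
    ann: "\<And>n z. r n \<le> norm z \<Longrightarrow> norm z \<le> s n \<Longrightarrow> 1 / (20 * (real n + 1)) / 256 \<le>
       (norm (poly (pderiv (u (Suc n))) z) + norm (poly (pderiv (m (Suc n))) z)) * (s n - r n)"
    "\<And>n z. r n \<le> norm z \<Longrightarrow> norm z \<le> s n \<Longrightarrow>
       8 \<le> norm (poly (pderiv (u (Suc n))) z) + norm (poly (pderiv (m (Suc n))) z)"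
    by (rule perturbation_sequence) blast
  have incR: "incseq R"
    using rs by (intro incseq_SucI) (meson less_imp_le order_trans)
  obtain U where U: "U holomorphic_on ball 0 1"
    "\<And>z. z \<in> ball 0 1 \<Longrightarrow> (\<lambda>n. poly (u n) z) \<longlonglongrightarrow> U z"
    "\<And>z. z \<in> ball 0 1 \<Longrightarrow> (\<lambda>n. poly (pderiv (u n)) z) \<longlonglongrightarrow> deriv U z"
    using poly_sequence_limit[OF R(3,2) incR step(1)] by blast
  obtain M where M: "M holomorphic_on ball 0 1"
    "\<And>z. z \<in> ball 0 1 \<Longrightarrow> (\<lambda>n. poly (m n) z) \<longlonglongrightarrow> M z"
    "\<And>z. z \<in> ball 0 1 \<Longrightarrow> (\<lambda>n. poly (pderiv (m n)) z) \<longlonglongrightarrow> deriv M z"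
    using poly_sequence_limit[OF R(3,2) incR step(2)] by blast
  obtain W where W: "W holomorphic_on ball 0 1"
    "\<And>z. z \<in> ball 0 1 \<Longrightarrow> (\<lambda>n. poly (w n) z) \<longlonglongrightarrow> W z"
    "\<And>z. z \<in> ball 0 1 \<Longrightarrow> (\<lambda>n. poly (pderiv (w n)) z) \<longlonglongrightarrow> deriv W z"
    using poly_sequence_limit[OF R(3,2) incR step(3)] by blast
  have close: "norm (deriv U z - poly (pderiv (u n)) z) \<le> 2 * (1 / 8) / 2 ^ n"
    "norm (deriv M z - poly (pderiv (m n)) z) \<le> 2 * (1 / 8) / 2 ^ n" if "norm z \<le> R n" for n z
  proof -
    have z: "z \<in> ball 0 1" using that R(2)[of n] by simp
    have k: "norm z \<le> R k" if "n \<le> k" for k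
      using incseqD[OF incR that] \<open>norm z \<le> R n\<close> by simp
    show "norm (deriv U z - poly (pderiv (u n)) z) \<le> 2 * (1 / 8) / 2 ^ n"
      by (rule limit_close_to_term[OF _ U(3)[OF z]]) (use step'(1) k in \<open>simp add: pderiv_diff\<close>)
    show "norm (deriv M z - poly (pderiv (m n)) z) \<le> 2 * (1 / 8) / 2 ^ n"
      by (rule limit_close_to_term[OF _ M(3)[OF z]]) (use step'(2) k in \<open>simp add: pderiv_diff\<close>)
  qed
  have ann': "1 / (20 * (real n + 1)) / 512 \<le> (norm (deriv U z) + norm (deriv M z)) * (s n - r n) \<and>
      7 \<le> norm (deriv U z) + norm (deriv M z)" if z: "r n \<le> norm z" "norm z \<le> s n" for n z
  proof -
    let ?Y = "norm (poly (pderiv (u (Suc n))) z) + norm (poly (pderiv (m (Suc n))) z)"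
      and ?X = "norm (deriv U z) + norm (deriv M z)"
    have "norm z \<le> R (Suc n)" using z rs(3)[of n] by simp
    note close[OF this]
    \<comment> \<open>The annulus lies in the disk of radius \<open>R (Suc n)\<close>, so later
      steps move each derivative by at most 1/8, the sum by 1/4. Of a sum of at least 8 there remain
      at least 7 and at least half, which turns 256 into 512.\<close>
    moreover have "2 * (1 / 8) / 2 ^ Suc n \<le> (1 / 8 :: real)" by (simp add: field_simps)
    ultimately have "?Y \<le> ?X + 1 / 4"
      using norm_triangle_ineq2[of "poly (pderiv (u (Suc n))) z" "deriv U z"]
        norm_triangle_ineq2[of "poly (pderiv (m (Suc n))) z" "deriv M z"]
      unfolding norm_minus_commute[of "poly _ _"] by linarith
    then have "7 \<le> ?X" and "?Y \<le> 2 * ?X" using ann(2)[OF z] by auto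
    moreover have "?Y * (s n - r n) \<le> 2 * ?X * (s n - r n)"
      using \<open>?Y \<le> 2 * ?X\<close> rs(2)[of n] by (intro mult_right_mono) auto
    moreover have "a / 512 \<le> x" if "a / 256 \<le> y" "y \<le> 2 * x" for a x y :: real
      using that by linarith
    ultimately show ?thesis using ann(1)[OF z] by (simp only: mult.assoc)
  qed
  show thesis
  proof (rule that[of U M W r s])
    show "deriv W z = M z * deriv U z" if "z \<in> ball 0 1" for z
    proof (rule LIMSEQ_unique[OF W(3)[OF that]])
      show "(\<lambda>n. poly (pderiv (w n)) z) \<longlonglongrightarrow> M z * deriv U z"
        unfolding w poly_mult by (intro tendsto_mult M(2) U(3) that)
    qed
    note bd = potential_disk_bounds[OF pot]
    show "\<bar>Re (U z)\<bar> \<le> 1" if "z \<in> ball 0 1" for z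
      by (rule Lim_bounded[where M = 0 and f = "\<lambda>n. \<bar>Re (poly (u n) z)\<bar>"])
         (use bd[OF _ that] in \<open>auto intro!: tendsto_intros U(2) that\<close>)
    show "\<bar>Re (W z)\<bar> \<le> 1" if "z \<in> ball 0 1" for z
      by (rule Lim_bounded[where M = 0 and f = "\<lambda>n. \<bar>Re (poly (w n) z)\<bar>"])
         (use bd[OF _ that] in \<open>auto intro!: tendsto_intros W(2) that\<close>)
    show "norm (M z - \<i>) \<le> 1" if "z \<in> ball 0 1" for z
      by (rule Lim_bounded[where M = 0 and f = "\<lambda>n. norm (poly (m n) z - \<i>)"])
         (use bd[OF _ that] in \<open>auto intro!: tendsto_intros M(2) that\<close>)
    \<comment> \<open>The slope 1/2 of the initial \<open>m\<close> exceeds the total change of the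
      derivative at 0.\<close>
    have "norm (deriv M 0 - 1 / 2) \<le> 1 / 4"
      using close(2)[of 0 0] R(1)[of 0] by (simp add: m0 pderiv_pCons)
    then show "deriv M 0 \<noteq> 0" by (auto simp: norm_divide)
    show "0 \<le> r n" for n using R(1)[of n] rs(1)[of n] by simp
    show "s n \<le> r (Suc n)" for n using rs(3)[of n] rs(1)[of "Suc n"] by simp
    show "s n < 1" for n using rs(3)[of n] R(2)[of "Suc n"] by simp
  qed (use U(1) M(1) W(1) rs(2) ann' in blast)+
qed

section \<open>From the limit functions to an immersed Legendrian curve\<close>

lemma has_derivative_vec_of_holomorphic:
  fixes F :: "complex \<Rightarrow> complex ^ 'n"
  assumes "holomorphic_map_on F S" "open S" "z \<in> S"
  shows "(F has_derivative (\<lambda>v. \<chi> i. deriv (\<lambda>z. F z $ i) z * v)) (at z)"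
proof (subst has_derivative_componentwise_within, rule ballI)
  fix b :: "complex ^ 'n" assume "b \<in> Basis"
  then obtain i c where b: "b = axis i c" by (auto simp: Basis_vec_def)
  have "((\<lambda>z. F z $ i) has_field_derivative deriv (\<lambda>z. F z $ i) z) (at z)"
    using assms by (auto simp: holomorphic_map_on_def intro: holomorphic_derivI)
  then have "((\<lambda>z. F z $ i) has_derivative (\<lambda>v. deriv (\<lambda>z. F z $ i) z * v)) (at z)"
    by (simp add: has_field_derivative_def)
  then show "((\<lambda>x. F x \<bullet> b) has_derivative (\<lambda>v. (\<chi> i. deriv (\<lambda>z. F z $ i) z * v) \<bullet> b)) (at z)"
    unfolding b inner_axis by (auto intro: has_derivative_inner_left)
qed

lemma norm_vec_mult_right:
  fixes a :: "'n::finite \<Rightarrow> complex"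
  shows "norm (\<chi> i. a i * v) = norm (\<chi> i. a i) * norm v"
  by (simp add: norm_vec_def norm_mult L2_set_left_distrib)

text \<open>The real derivative sends \<open>v\<close> to the complex multiple by \<open>v\<close>
  of one fixed vector. It therefore stretches all directions equally, and it is injective as soon as
  that vector is nonzero.\<close>

lemma conformal_disk_of_holomorphic:
  fixes F :: "complex \<Rightarrow> complex ^ 'n"
  assumes hol: "holomorphic_map_on F (ball 0 1)"
    and nz: "\<And>z. z \<in> ball 0 1 \<Longrightarrow> (\<chi> i. deriv (\<lambda>z. F z $ i) z) \<noteq> 0"
  shows "conformal_disk F (\<lambda>z. norm (\<chi> i. deriv (\<lambda>z. F z $ i) z))"
    and "immersion_on F (ball 0 1)"
proof -
  note der = has_derivative_vec_of_holomorphic[OF hol open_ball]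
  have fd: "frechet_derivative F (at z) = (\<lambda>v. \<chi> i. deriv (\<lambda>z. F z $ i) z * v)" if "z \<in> ball 0 1" for z
    using frechet_derivative_at[OF der[OF that]] by simp
  show "conformal_disk F (\<lambda>z. norm (\<chi> i. deriv (\<lambda>z. F z $ i) z))"
  proof
    show "continuous_on (ball 0 1) (\<lambda>z. norm (\<chi> i. deriv (\<lambda>z. F z $ i) z))"
      using hol unfolding holomorphic_map_on_def
      by (intro continuous_intros holomorphic_on_imp_continuous_on holomorphic_deriv) auto
  qed (use nz fd norm_vec_mult_right in auto)
  have "inj (frechet_derivative F (at z))" if z: "z \<in> ball 0 1" for z
  proof -
    have "linear (frechet_derivative F (at z))"
      using has_derivative_linear[OF der[OF z]] fd[OF z] by simp
    moreover have "v = 0" if "frechet_derivative F (at z) v = 0" for v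
    proof -
      have "norm (\<chi> i. deriv (\<lambda>z. F z $ i) z) * norm v = 0"
        using that fd[OF z] norm_vec_mult_right[of "\<lambda>i. deriv (\<lambda>z. F z $ i) z" v] by simp
      then show ?thesis using nz[OF z] by simp
    qed
    ultimately show ?thesis using linear_injective_0 by blast
  qed
  then show "immersion_on F (ball 0 1)"
    unfolding immersion_on_def using der differentiableI by blast
qed

text \<open>The derivative of \<open>m\<close> is not identically zero, so it has countably many
  zeros; each excludes one value of \<open>\<delta>\<close>, and a disk is uncountable.\<close>

lemma exists_injective_shift:
  assumes u: "u holomorphic_on ball 0 1" and m: "m holomorphic_on ball 0 1" and m0: "deriv m 0 \<noteq> 0"
  obtains \<delta> where "norm \<delta> < 1" "\<And>z. z \<in> ball 0 1 \<Longrightarrow> deriv m z = 0 \<Longrightarrow> deriv u z + \<delta> \<noteq> 0"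
proof -
  let ?Z = "{z \<in> ball 0 1. deriv m z = 0}"
  have "countable ?Z"
  proof (cases "deriv m constant_on ball 0 1")
    case True
    then have "?Z = {}" using m0 by (force simp: constant_on_def)
    then show ?thesis by (metis countable_empty)
  next
    case False
    obtain C :: "nat \<Rightarrow> complex set" where "\<And>n. compact (C n)" "\<Union> (range C) = ball 0 1"
      using open_Union_compact_subsets[OF open_ball] by metis
    then have "fsigma (ball (0 :: complex) 1)"
      unfolding fsigma_Union_compact by blast
    with False show ?thesis
      by (intro holomorphic_countable_zeros holomorphic_deriv m open_ball connected_ball)
  qed
  then have "countable ((\<lambda>z. - deriv u z) ` ?Z)" by (rule countable_image)
  moreover have "uncountable (ball (0 :: complex) 1)" by (rule uncountable_ball) simp
  ultimately have "\<not> ball 0 1 \<subseteq> (\<lambda>z. - deriv u z) ` ?Z" using countable_subset by blast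
  then obtain \<delta> where \<delta>: "\<delta> \<in> ball 0 1" "\<delta> \<notin> (\<lambda>z. - deriv u z) ` ?Z" by blast
  show thesis
  proof (rule that[of \<delta>])
    show "norm \<delta> < 1" using \<delta>(1) by simp
    show "deriv u z + \<delta> \<noteq> 0" if "z \<in> ball 0 1" "deriv m z = 0" for z
      using \<delta>(2) that by (auto simp: image_iff add_eq_0_iff)
  qed
qed

theorem mainTheorem2:
  shows "\<exists>F :: complex \<Rightarrow> complex ^ 3.
           holomorphic_map_on F (ball 0 1) \<and>
           immersion_on F (ball 0 1) \<and>
           legendrian_on F (ball 0 1) \<and>
           complete_riemannian (ball 0 1) (pullback_metric F) \<and>
           bounded (F ` ball 0 1)"
proof -
  obtain w m u :: "complex \<Rightarrow> complex" and r s :: "nat \<Rightarrow> real" where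
    hol: "u holomorphic_on ball 0 1" "m holomorphic_on ball 0 1" "w holomorphic_on ball 0 1" and
    w': "\<And>z. z \<in> ball 0 1 \<Longrightarrow> deriv w z = m z * deriv u z" and
    Re_u: "\<And>z. z \<in> ball 0 1 \<Longrightarrow> \<bar>Re (u z)\<bar> \<le> 1" and
    Re_w: "\<And>z. z \<in> ball 0 1 \<Longrightarrow> \<bar>Re (w z)\<bar> \<le> 1" and
    m_i: "\<And>z. z \<in> ball 0 1 \<Longrightarrow> norm (m z - \<i>) \<le> 1" and
    m0: "deriv m 0 \<noteq> 0" and
    rs: "\<And>n. 0 \<le> r n" "\<And>n. r n < s n" "\<And>n. s n \<le> r (Suc n)" "\<And>n. s n < 1" and
    ann: "\<And>n z. r n \<le> norm z \<Longrightarrow> norm z \<le> s n \<Longrightarrow>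
       1 / (20 * (real n + 1)) / 512 \<le> (norm (deriv u z) + norm (deriv m z)) * (s n - r n)"
    "\<And>n z. r n \<le> norm z \<Longrightarrow> norm z \<le> s n \<Longrightarrow> 7 \<le> norm (deriv u z) + norm (deriv m z)"
    by (rule limit_curve) blast
  obtain \<delta> where \<delta>: "norm \<delta> < 1" "\<And>z. z \<in> ball 0 1 \<Longrightarrow> deriv m z = 0 \<Longrightarrow> deriv u z + \<delta> \<noteq> 0"
    by (rule exists_injective_shift[OF hol(1,2) m0]) blast
  \<comment> \<open>Adding \<open>\<delta> * z\<close> to \<open>u\<close> preserves the relation
    \<open>dw = m du\<close> only if \<open>\<delta>\<close> times a primitive of \<open>m\<close>
    is added to \<open>w\<close>.\<close>
  obtain W where W: "\<And>z. z \<in> ball 0 1 \<Longrightarrow> (W has_field_derivative m z) (at z)"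
    using holomorphic_convex_primitive'[OF convex_ball open_ball hol(2)]
    by (metis at_within_open open_ball)
  have m2: "norm (m z) \<le> 2" and m1: "norm (m z - 1) \<le> 3" if "z \<in> ball 0 1" for z
  proof -
    show "norm (m z) \<le> 2" using m_i[OF that] norm_triangle_ineq[of "m z - \<i>" \<i>] by simp
    then show "norm (m z - 1) \<le> 3" using norm_triangle_ineq4[of "m z" 1] by simp
  qed
  have W2: "norm (W z - W 0) \<le> 2" if "z \<in> ball 0 1" for z
  proof -
    have "norm (W z - W 0) \<le> 2 * norm (z - 0)"
      by (rule field_differentiable_bound[of "ball 0 1" W m])
         (use W m2 that in \<open>auto intro: DERIV_subset\<close>)
    then show ?thesis using that by simp
  qed
  define U where "U z = u z + \<delta> * z" for z
  define V where "V z = w z + \<delta> * (W z - W 0)" for z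
  define U' where "U' z = deriv u z + \<delta>" for z
  have dm: "(m has_field_derivative deriv m z) (at z)" if "z \<in> ball 0 1" for z
    using hol(2) that by (intro holomorphic_derivI[of m "ball 0 1"]) auto
  have dU: "(U has_field_derivative U' z) (at z)" if "z \<in> ball 0 1" for z
    unfolding U_def U'_def
    using holomorphic_derivI[OF hol(1) open_ball that]
    by (auto intro!: derivative_eq_intros)
  have dV: "(V has_field_derivative m z * U' z) (at z)" if "z \<in> ball 0 1" for z
    unfolding V_def U'_def
    using holomorphic_derivI[OF hol(3) open_ball that] W[OF that] w'[OF that]
    by (auto intro!: derivative_eq_intros simp: algebra_simps)
  have Re_U: "\<bar>Re (U z)\<bar> \<le> 2" and Re_V: "\<bar>Re (V z)\<bar> \<le> 3" if "z \<in> ball 0 1" for z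
  proof -
    have "norm (\<delta> * z) \<le> 1 * 1" unfolding norm_mult using \<delta>(1) that by (intro mult_mono) auto
    then show "\<bar>Re (U z)\<bar> \<le> 2"
      using Re_u[OF that] abs_Re_le_cmod[of "\<delta> * z"] by (simp add: U_def)
    have "norm (\<delta> * (W z - W 0)) \<le> 1 * 2"
      unfolding norm_mult using \<delta>(1) W2[OF that] by (intro mult_mono) auto
    then show "\<bar>Re (V z)\<bar> \<le> 3"
      using Re_w[OF that] abs_Re_le_cmod[of "\<delta> * (W z - W 0)"] by (simp add: V_def)
  qed
  define F :: "complex \<Rightarrow> complex ^ 3" where
    "F z = vector [exp (U z), - m z * exp (V z - U z), exp (V z)]" for z
  have F: "F z $ 1 = exp (U z)" "F z $ 2 = - m z * exp (V z - U z)" "F z $ 3 = exp (V z)" for z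
    by (simp_all add: F_def vector_3)
  have dF: "((\<lambda>z. F z $ 1) has_field_derivative exp (U z) * U' z) (at z)"
    "((\<lambda>z. F z $ 2) has_field_derivative
        - exp (V z - U z) * (deriv m z + m z * (m z - 1) * U' z)) (at z)"
    "((\<lambda>z. F z $ 3) has_field_derivative exp (V z) * (m z * U' z)) (at z)" if "z \<in> ball 0 1" for z
    unfolding F using dU[OF that] dV[OF that] dm[OF that]
    by (auto intro!: derivative_eq_intros simp: algebra_simps)
  have holF: "holomorphic_map_on F (ball 0 1)"
    unfolding holomorphic_map_on_def forall_3 holomorphic_on_open[OF open_ball] using dF by blast
  define D where "D z = (\<chi> i. deriv (\<lambda>z. F z $ i) z)" for z
  have D: "D z $ 1 = exp (U z) * U' z"
    "D z $ 2 = - exp (V z - U z) * (deriv m z + m z * (m z - 1) * U' z)"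
    "D z $ 3 = exp (V z) * (m z * U' z)" if "z \<in> ball 0 1" for z
    unfolding D_def using dF[OF that] by (simp_all add: DERIV_imp_deriv)
  \<comment> \<open>The first coordinate gives \<open>U'\<close> at cost \<open>exp 2\<close>. The
    second gives the derivative of \<open>m\<close> at cost \<open>exp 5\<close>, from the bounds 2
    and 3 on the real parts of \<open>U\<close> and \<open>V\<close>, plus
    \<open>2 * 3 * exp 2\<close> from removing the \<open>U'\<close> term.\<close>
  define K :: real where "K = exp 5 + 7 * exp 2"
  have K: "0 < K" unfolding K_def by (intro add_pos_pos) auto
  have bound: "norm (U' z) + norm (deriv m z) \<le> K * norm (D z)" if z: "z \<in> ball 0 1" for z
  proof -
    have "norm (U' z) = norm (exp (- U z) * D z $ 1)"
      by (simp add: D[OF z] exp_minus field_simps)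
    also have "\<dots> = exp (- Re (U z)) * norm (D z $ 1)" by (simp add: norm_mult)
    also have "\<dots> \<le> exp 2 * norm (D z)"
      using Re_U[OF z] by (intro mult_mono) (auto simp: Finite_Cartesian_Product.norm_nth_le)
    finally have 1: "norm (U' z) \<le> exp 2 * norm (D z)" .
    have "deriv m z = - exp (U z - V z) * D z $ 2 - m z * (m z - 1) * U' z"
      by (simp add: D[OF z] exp_diff)
    then have "norm (deriv m z) \<le> norm (- exp (U z - V z) * D z $ 2) + norm (m z * (m z - 1) * U' z)"
      by (metis norm_triangle_ineq4)
    also have "norm (- exp (U z - V z) * D z $ 2) = exp (Re (U z) - Re (V z)) * norm (D z $ 2)"
      by (simp add: norm_mult)
    also have "\<dots> \<le> exp 5 * norm (D z)"
      using Re_U[OF z] Re_V[OF z] by (intro mult_mono) (auto simp: Finite_Cartesian_Product.norm_nth_le)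
    also have "norm (m z * (m z - 1) * U' z) \<le> 2 * 3 * (exp 2 * norm (D z))"
      unfolding norm_mult using m1[OF z] m2[OF z] 1 by (intro mult_mono) auto
    finally show ?thesis using 1 by (simp add: K_def algebra_simps)
  qed
  have D_nz: "D z \<noteq> 0" if z: "z \<in> ball 0 1" for z
  proof
    assume "D z = 0"
    then have "norm (U' z) + norm (deriv m z) \<le> 0" using bound[OF z] by simp
    then have "norm (U' z) \<le> 0" "norm (deriv m z) \<le> 0"
      using norm_ge_zero[of "U' z"] norm_ge_zero[of "deriv m z"] by linarith+
    then have "U' z = 0" "deriv m z = 0" by simp_all
    then show False using \<delta>(2)[OF z] by (simp add: U'_def)
  qed
  interpret conformal_disk F "\<lambda>z. norm (D z)"
    using conformal_disk_of_holomorphic(1)[OF holF] D_nz by (simp add: D_def)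
  have "complete_riemannian (ball 0 1) (pullback_metric F)"
  \<comment> \<open>The constant 20480 is 20 * 512 * 2, the last factor paying for the shift by
    \<open>\<delta>\<close>.\<close>
  proof (rule complete_of_annuli[where L = "\<lambda>n. 1 / (20480 * K) * inverse (real (Suc n))" and r = r and s = s, OF rs])
    show "0 < 1 / (20480 * K) * inverse (real (Suc n))" for n using K by simp
    show "\<not> summable (\<lambda>n. 1 / (20480 * K) * inverse (real (Suc n)))"
      using K not_summable_harmonic[where 'a = real]
      by (simp add: summable_cmult_iff summable_Suc_iff[of "\<lambda>n. inverse (real n)"] del: of_nat_Suc)
    fix n and z :: complex assume z: "r n \<le> norm z" "norm z \<le> s n"
    then have z1: "z \<in> ball 0 1" using rs(4)[of n] by simp
    let ?X = "norm (deriv u z) + norm (deriv m z)"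
    \<comment> \<open>The shift changes the sum of the two norms by at most 1, which is less than
      half of it because the sum is at least 7 on the annulus.\<close>
    have "norm (deriv u z) \<le> norm (U' z) + 1"
      using norm_triangle_ineq4[of "U' z" \<delta>] \<delta>(1) by (simp add: U'_def)
    then have "?X \<le> 2 * (norm (U' z) + norm (deriv m z))" using ann(2)[OF z] by simp
    also have "\<dots> \<le> 2 * (K * norm (D z))" using bound[OF z1] by simp
    finally have "?X * (s n - r n) \<le> 2 * (K * norm (D z)) * (s n - r n)"
      using rs(2)[of n] by (intro mult_right_mono) auto
    then have "1 / (20 * (real n + 1)) / 512 \<le> 2 * K * (norm (D z) * (s n - r n))"
      using ann(1)[OF z] by (simp add: mult.assoc)
    then have "1 / (20 * (real n + 1)) / 512 / (2 * K) \<le> norm (D z) * (s n - r n)"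
      using K by (subst pos_divide_le_eq) (simp_all add: mult_ac)
    then show "1 / (20480 * K) * inverse (real (Suc n)) \<le> norm (D z) * (s n - r n)"
      by (simp add: field_simps)
  qed
  moreover have "legendrian_on F (ball 0 1)"
    unfolding legendrian_on_def contact_form_def
  proof (intro ballI allI)
    fix z v :: complex assume z: "z \<in> ball 0 1"
    have "frechet_derivative F (at z) v = (\<chi> i. D z $ i * v)"
      using frechet_derivative_at[OF has_derivative_vec_of_holomorphic[OF holF open_ball z]]
      by (simp add: D_def fun_eq_iff)
    then show "frechet_derivative F (at z) v $ 3 + F z $ 2 * frechet_derivative F (at z) v $ 1 = 0"
      by (simp add: D[OF z] F exp_diff)
  qed
  moreover have "bounded (F ` ball 0 1)"
    unfolding bounded_iff
  proof (intro exI ballI)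
    fix y assume "y \<in> F ` ball 0 1"
    then obtain z where z: "z \<in> ball 0 1" "y = F z" by blast
    have "norm y \<le> (\<Sum>i\<in>UNIV. norm (y $ i))"
      unfolding norm_vec_def by (rule L2_set_le_sum) simp
    also have "\<dots> = exp (Re (U z)) + norm (m z) * exp (Re (V z) - Re (U z)) + exp (Re (V z))"
      by (simp add: sum_3 z(2) F norm_mult)
    also have "\<dots> \<le> exp 2 + 2 * exp 5 + exp 3"
      using Re_U[OF z(1)] Re_V[OF z(1)] m2[OF z(1)] by (intro add_mono mult_mono) auto
    finally show "norm y \<le> exp 2 + 2 * exp 5 + exp 3" .
  qed
  moreover have "immersion_on F (ball 0 1)"
    using conformal_disk_of_holomorphic(2)[OF holF] D_nz by (simp add: D_def)
  ultimately show ?thesis using holF by blast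
qed

end
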